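(* Let $R\subset S$ be an integral catenarian FCP extension of commutative rings. Then the co-infra-integral closure of $R\subset S$ exists.
   Context: All rings are commutative and unital; $\subset$ denotes proper inclusion. $[R,S]$ is the set of all $R$-subalgebras of $S$, ordered by inclusion; $R\subseteq S$ has FCP if each chain in $[R,S]$ is finite. An FCP extension $R\subseteq S$ is catenarian if all maximal chains of $[R,S]$ have the same length. An integral extension $U\subseteq S$ is infra-integral if all its residual field extensions $\kappa_U(Q\cap U)\to\kappa_S(Q)$ ($Q\in\mathrm{Spec}(S)$) are isomorphisms. The co-infra-integral closure of $R\subseteq S$, if it exists, is the least $V\in[R,S]$ such that $V\subseteq S$ is infra-integral. *)

theory Defs
  imports "HOL-Algebra.Polynomials"
begin

text \<open>
  A ring extension is given by a commutative ring \<open>S\<close> and the carrier \<open>R\<close> of a subring of \<open>S\<close>;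
  the ring on that carrier is \<open>S\<lparr>carrier := R\<rparr>\<close>.
\<close>

definition intermediate_rings :: "('a, 'm) ring_scheme \<Rightarrow> 'a set \<Rightarrow> 'a set set" where
  "intermediate_rings S R = {T. subring T S \<and> R \<subseteq> T}"

definition FCP_extension :: "('a, 'm) ring_scheme \<Rightarrow> 'a set \<Rightarrow> bool" where
  "FCP_extension S R \<longleftrightarrow>
     (\<forall>C. subset.chain (intermediate_rings S R) C \<longrightarrow> finite C)"

definition chain_length :: "'b set \<Rightarrow> nat" where
  "chain_length C = card C - 1"

definition catenarian_extension :: "('a, 'm) ring_scheme \<Rightarrow> 'a set \<Rightarrow> bool" where
  "catenarian_extension S R \<longleftrightarrow>
     FCP_extension S R \<and>
     (\<forall>C D. subset.maxchain (intermediate_rings S R) C \<longrightarrow>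
            subset.maxchain (intermediate_rings S R) D \<longrightarrow>
            chain_length C = chain_length D)"

text \<open>
  Polynomials are lists of coefficients with the leading one first, so \<open>\<one> # p\<close> with entries of
  \<open>p\<close> in \<open>U\<close> is a monic polynomial over \<open>U\<close> of degree \<open>length p\<close>.
\<close>

definition integral_extension :: "('a, 'm) ring_scheme \<Rightarrow> 'a set \<Rightarrow> bool" where
  "integral_extension S U \<longleftrightarrow>
     (\<forall>x \<in> carrier S. \<exists>p. set p \<subseteq> U \<and> ring.eval S (\<one>\<^bsub>S\<^esub> # p) x = \<zero>\<^bsub>S\<^esub>)"


definition frac_rel :: "('a, 'm) ring_scheme \<Rightarrow> 'a set \<Rightarrow> (('a \<times> 'a) \<times> ('a \<times> 'a)) set" where
  "frac_rel A M =
     {((a, s), (b, t)) | a s b t. a \<in> carrier A \<and> s \<in> M \<and> b \<in> carrier A \<and> t \<in> M \<and>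
        (\<exists>u \<in> M. u \<otimes>\<^bsub>A\<^esub> (t \<otimes>\<^bsub>A\<^esub> a) = u \<otimes>\<^bsub>A\<^esub> (s \<otimes>\<^bsub>A\<^esub> b))}"

definition fraction :: "('a, 'm) ring_scheme \<Rightarrow> 'a set \<Rightarrow> 'a \<Rightarrow> 'a \<Rightarrow> ('a \<times> 'a) set" where
  "fraction A M a s = frac_rel A M `` {(a, s)}"

definition localization :: "('a, 'm) ring_scheme \<Rightarrow> 'a set \<Rightarrow> ('a \<times> 'a) set ring" where
  "localization A M =
     \<lparr>carrier = (carrier A \<times> M) // frac_rel A M,
      monoid.mult = (\<lambda>F G. \<Union>(a, s) \<in> F. \<Union>(b, t) \<in> G. fraction A M (a \<otimes>\<^bsub>A\<^esub> b) (s \<otimes>\<^bsub>A\<^esub> t)),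
      one = fraction A M \<one>\<^bsub>A\<^esub> \<one>\<^bsub>A\<^esub>,
      zero = fraction A M \<zero>\<^bsub>A\<^esub> \<one>\<^bsub>A\<^esub>,
      add = (\<lambda>F G. \<Union>(a, s) \<in> F. \<Union>(b, t) \<in> G.
               fraction A M ((t \<otimes>\<^bsub>A\<^esub> a) \<oplus>\<^bsub>A\<^esub> (s \<otimes>\<^bsub>A\<^esub> b)) (s \<otimes>\<^bsub>A\<^esub> t))\<rparr>"

definition local_ring_at :: "('a, 'm) ring_scheme \<Rightarrow> 'a set \<Rightarrow> ('a \<times> 'a) set ring" where
  "local_ring_at A P = localization A (carrier A - P)"

definition local_max_ideal :: "('a, 'm) ring_scheme \<Rightarrow> 'a set \<Rightarrow> ('a \<times> 'a) set set" where
  "local_max_ideal A P = {fraction A (carrier A - P) a s | a s. a \<in> P \<and> s \<in> carrier A - P}"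

definition residue_field :: "('a, 'm) ring_scheme \<Rightarrow> 'a set \<Rightarrow> ('a \<times> 'a) set set ring" where
  "residue_field A P = local_ring_at A P Quot local_max_ideal A P"

text \<open>
  The map \<open>U\<^bsub>Q \<inter> U\<^esub> \<rightarrow> S\<^bsub>Q\<^esub>\<close> sends \<open>a/s\<close> to \<open>a/s\<close>, and the residual extension is the map it induces on
  residue fields. In both definitions all representatives yield the same class, so the union over
  the representatives is that class.
\<close>

definition local_map ::
  "('a, 'm) ring_scheme \<Rightarrow> 'a set \<Rightarrow> ('a \<times> 'a) set \<Rightarrow> ('a \<times> 'a) set" where
  "local_map S Q F = (\<Union>(a, s) \<in> F. fraction S (carrier S - Q) a s)"

definition residual_extension ::
  "('a, 'm) ring_scheme \<Rightarrow> 'a set \<Rightarrow> ('a \<times> 'a) set set \<Rightarrow> ('a \<times> 'a) set set" where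
  "residual_extension S Q K =
     (\<Union>F \<in> K. local_max_ideal S Q +>\<^bsub>local_ring_at S Q\<^esub> local_map S Q F)"

definition infra_integral_extension :: "('a, 'm) ring_scheme \<Rightarrow> 'a set \<Rightarrow> bool" where
  "infra_integral_extension S U \<longleftrightarrow>
     integral_extension S U \<and>
     (\<forall>Q. primeideal Q S \<longrightarrow>
        residual_extension S Q
          \<in> ring_iso (residue_field (S\<lparr>carrier := U\<rparr>) (Q \<inter> U)) (residue_field S Q))"

definition is_co_infra_integral_closure ::
  "('a, 'm) ring_scheme \<Rightarrow> 'a set \<Rightarrow> 'a set \<Rightarrow> bool" where
  "is_co_infra_integral_closure S R V \<longleftrightarrow>
     V \<in> intermediate_rings S R \<and> infra_integral_extension S V \<and>
     (\<forall>W \<in> intermediate_rings S R. infra_integral_extension S W \<longrightarrow> V \<subseteq> W)"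

end

theory Submission
  imports Defs
begin

text \<open>
  Since all maximal chains of intermediate rings are finite of the same length, the intermediate rings carry a
  rank, and it suffices to show that the intermediate rings \<open>V\<close> with \<open>V \<subseteq> S\<close> infra-integral are closed under
  binary intersection; the one of least rank is then the least. A confluence argument reduces this to two
  distinct maximal subrings \<open>V\<^sub>1, V\<^sub>2\<close> of an intermediate ring \<open>W\<close>, with conductors \<open>M\<^sub>1, M\<^sub>2\<close>.

  If a proper subring \<open>T\<close> of \<open>V\<^sub>1\<close> contained \<open>M\<^sub>1\<close>, choose a prime \<open>Q\<close> of \<open>W\<close> over \<open>M\<^sub>1\<close>. Then \<open>W = V\<^sub>1 + Q\<close>, so
  \<open>T + Q\<close> has the same corank in \<open>W\<close> as \<open>T\<close> has in \<open>V\<^sub>1\<close>, and its rank exceeds that of \<open>T\<close> by exactly one. But \<open>Q\<close>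
  contains an element \<open>q\<close> outside \<open>M\<^sub>1\<close> which is idempotent or square-zero modulo \<open>M\<^sub>1\<close>, and \<open>T + T q\<close> lies strictly
  between \<open>T\<close> and \<open>T + Q\<close>. Hence \<open>M\<^sub>1\<close> is not contained in \<open>V\<^sub>2\<close>, nor \<open>M\<^sub>2\<close> in \<open>V\<^sub>1\<close>. By maximality
  \<open>V\<^sub>2 + M\<^sub>1 = W = V\<^sub>1 + M\<^sub>2\<close>, so \<open>V\<^sub>1\<close> and \<open>V\<^sub>1 \<inter> V\<^sub>2\<close> have the same image modulo every prime containing \<open>M\<^sub>1\<close>,
  symmetrically for \<open>M\<^sub>2\<close>, and at the remaining primes denominators can be taken in \<open>M\<^sub>1 M\<^sub>2\<close>.
\<close>

section \<open>Rank functions of catenary families of sets\<close>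

definition covered_in :: "'b set set \<Rightarrow> 'b set \<Rightarrow> 'b set \<Rightarrow> bool" where
  "covered_in \<F> V W \<longleftrightarrow>
     V \<in> \<F> \<and> W \<in> \<F> \<and> V \<subset> W \<and> (\<forall>Z\<in>\<F>. V \<subseteq> Z \<longrightarrow> Z \<subseteq> W \<longrightarrow> Z = V \<or> Z = W)"

text \<open>A properly larger chain contains an element outside the given one, so maximality can be
  tested by adjoining one element at a time.\<close>

lemma subset_maxchain_iff:
  "subset.maxchain \<F> C \<longleftrightarrow>
     subset.chain \<F> C \<and> (\<forall>Z\<in>\<F>. (\<forall>Y\<in>C. Z \<subseteq> Y \<or> Y \<subseteq> Z) \<longrightarrow> Z \<in> C)" (is "?L \<longleftrightarrow> ?R")
proof
  assume L: ?L
  then have C: "subset.chain \<F> C" by (rule subset.maxchain_imp_chain)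
  moreover have "Z \<in> C" if Z: "Z \<in> \<F>" "\<forall>Y\<in>C. Z \<subseteq> Y \<or> Y \<subseteq> Z" for Z
  proof (rule ccontr)
    assume "Z \<notin> C"
    moreover have "subset.chain \<F> (insert Z C)"
      using C Z unfolding subset_chain_insert by blast
    ultimately show False
      using L unfolding subset.maxchain_def by blast
  qed
  ultimately show ?R by blast
next
  assume R: ?R
  have False if "subset.chain \<F> D" "C \<subset> D" for D
  proof -
    obtain Z where Z: "Z \<in> D" "Z \<notin> C" using \<open>C \<subset> D\<close> by blast
    then have "Z \<in> \<F>" "\<forall>Y\<in>C. Z \<subseteq> Y \<or> Y \<subseteq> Z"
      using that unfolding subset_chain_def by blast+
    then show False using R Z by blast
  qed
  then show ?L using R unfolding subset.maxchain_def by blast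
qed

text \<open>Whatever is comparable with all of \<open>C \<union> D\<close> is comparable with
  \<open>V\<close>, hence lies in one of the two halves, where maximality of \<open>C\<close> or
  \<open>D\<close> captures it. \<open>V\<close> belongs to both for the same reason, so the
  cardinalities add up with exactly one overlap.\<close>

lemma maxchain_join:
  assumes V: "V \<in> \<F>"
    and C: "subset.maxchain {Z \<in> \<F>. Z \<subseteq> V} C"
    and D: "subset.maxchain {Z \<in> \<F>. V \<subseteq> Z} D"
  shows "subset.maxchain \<F> (C \<union> D)" and "C \<inter> D = {V}"
proof -
  have chC: "C \<subseteq> {Z \<in> \<F>. Z \<subseteq> V}" "\<And>Z Y. Z \<in> C \<Longrightarrow> Y \<in> C \<Longrightarrow> Z \<subseteq> Y \<or> Y \<subseteq> Z"
    and mC: "\<And>Z. Z \<in> \<F> \<Longrightarrow> Z \<subseteq> V \<Longrightarrow> \<forall>Y\<in>C. Z \<subseteq> Y \<or> Y \<subseteq> Z \<Longrightarrow> Z \<in> C"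
    using C unfolding subset_maxchain_iff subset_chain_def by auto
  have chD: "D \<subseteq> {Z \<in> \<F>. V \<subseteq> Z}" "\<And>Z Y. Z \<in> D \<Longrightarrow> Y \<in> D \<Longrightarrow> Z \<subseteq> Y \<or> Y \<subseteq> Z"
    and mD: "\<And>Z. Z \<in> \<F> \<Longrightarrow> V \<subseteq> Z \<Longrightarrow> \<forall>Y\<in>D. Z \<subseteq> Y \<or> Y \<subseteq> Z \<Longrightarrow> Z \<in> D"
    using D unfolding subset_maxchain_iff subset_chain_def by auto
  have VC: "V \<in> C" and VD: "V \<in> D" using mC[OF V] mD[OF V] chC(1) chD(1) by blast+
  then show "C \<inter> D = {V}" using chC(1) chD(1) by blast
  have low: "Z \<subseteq> V" if "Z \<in> C" for Z using that chC(1) by blast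
  have high: "V \<subseteq> Z" if "Z \<in> D" for Z using that chD(1) by blast
  have "Z \<subseteq> Y \<or> Y \<subseteq> Z" if "Z \<in> C \<union> D" "Y \<in> C \<union> D" for Z Y
    using that chC(2)[of Z Y] chD(2)[of Z Y] low[of Z] low[of Y] high[of Z] high[of Y]
    by (meson UnE subset_trans)
  moreover have "Z \<in> C \<union> D" if "Z \<in> \<F>" "\<forall>Y\<in>C \<union> D. Z \<subseteq> Y \<or> Y \<subseteq> Z" for Z
    using that VC mC[of Z] mD[of Z] by blast
  ultimately show "subset.maxchain \<F> (C \<union> D)"
    using chC(1) chD(1) unfolding subset_maxchain_iff subset_chain_def by blast
qed

text \<open>Maximality forces \<open>V\<close> into \<open>C\<close>. A set below \<open>W\<close>
  that is comparable with \<open>V\<close> is either below \<open>V\<close>, where maximality of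
  \<open>C\<close> applies, or between \<open>V\<close> and \<open>W\<close>, where covering leaves
  only the two ends.\<close>

lemma maxchain_insert_cover:
  assumes VW: "covered_in \<F> V W" and C: "subset.maxchain {Z \<in> \<F>. Z \<subseteq> V} C"
  shows "subset.maxchain {Z \<in> \<F>. Z \<subseteq> W} (insert W C)"
proof -
  have chC: "C \<subseteq> {Z \<in> \<F>. Z \<subseteq> V}" "\<And>Z Y. Z \<in> C \<Longrightarrow> Y \<in> C \<Longrightarrow> Z \<subseteq> Y \<or> Y \<subseteq> Z"
    and mC: "\<And>Z. Z \<in> \<F> \<Longrightarrow> Z \<subseteq> V \<Longrightarrow> \<forall>Y\<in>C. Z \<subseteq> Y \<or> Y \<subseteq> Z \<Longrightarrow> Z \<in> C"
    using C unfolding subset_maxchain_iff subset_chain_def by auto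
  have V: "V \<in> \<F>" "W \<in> \<F>" "V \<subset> W"
    and cov: "\<And>Z. Z \<in> \<F> \<Longrightarrow> V \<subseteq> Z \<Longrightarrow> Z \<subseteq> W \<Longrightarrow> Z = V \<or> Z = W"
    using VW unfolding covered_in_def by auto
  have VC: "V \<in> C" using mC[OF V(1)] chC(1) by blast
  have "Z \<in> insert W C" if "Z \<in> \<F>" "Z \<subseteq> W" "\<forall>Y\<in>insert W C. Z \<subseteq> Y \<or> Y \<subseteq> Z" for Z
    using that VC mC[of Z] cov[of Z] by blast
  moreover have "insert W C \<subseteq> {Z \<in> \<F>. Z \<subseteq> W}" using chC(1) V by blast
  moreover have "Z \<subseteq> Y \<or> Y \<subseteq> Z" if "Z \<in> insert W C" "Y \<in> insert W C" for Z Y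
    using that chC V by blast
  ultimately show ?thesis unfolding subset_maxchain_iff subset_chain_def by simp
qed

text \<open>The range of an infinite strictly descending sequence would be an infinite
  chain.\<close>

lemma finite_chains_no_descent:
  assumes fin: "\<And>C. subset.chain \<F> C \<Longrightarrow> finite C"
  shows "wf {(Z, Y). Z \<in> \<F> \<and> Y \<in> \<F> \<and> Z \<subset> Y}"
  unfolding wf_iff_no_infinite_down_chain
proof
  assume "\<exists>f. \<forall>i. (f (Suc i), f i) \<in> {(Z, Y). Z \<in> \<F> \<and> Y \<in> \<F> \<and> Z \<subset> Y}"
  then obtain f where "\<forall>i. (f (Suc i), f i) \<in> {(Z, Y). Z \<in> \<F> \<and> Y \<in> \<F> \<and> Z \<subset> Y}" ..
  then have f: "\<And>i. f i \<in> \<F>" "\<And>i. f (Suc i) \<subset> f i" by auto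
  have less: "f j \<subset> f i" if "i < j" for i j
    using that by (induct rule: less_Suc_induct) (use f(2) in auto)
  then have "inj f" by (metis linorder_injI psubset_eq)
  moreover have "finite (range f)"
  proof (rule fin)
    have "f i \<subseteq> f j \<or> f j \<subseteq> f i" for i j
      using less[of i j] less[of j i] by (cases i j rule: linorder_cases) auto
    then show "subset.chain \<F> (range f)"
      unfolding subset_chain_def using f(1) by blast
  qed
  ultimately show False using finite_imageD infinite_UNIV_nat by blast
qed

text \<open>A nonempty chain is finite and so contains its own union; Zorn's lemma then yields a
  maximal member of the interval from \<open>V\<close> up to but excluding \<open>W\<close>.\<close>

lemma finite_chains_exists_cover:
  assumes fin: "\<And>C. subset.chain \<F> C \<Longrightarrow> finite C"
    and VW: "V \<in> \<F>" "W \<in> \<F>" "V \<subset> W"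
  obtains Z where "V \<subseteq> Z" "covered_in \<F> Z W"
proof -
  define \<G> where "\<G> = {Z \<in> \<F>. V \<subseteq> Z \<and> Z \<subset> W}"
  have "\<exists>M\<in>\<G>. \<forall>Z\<in>\<G>. M \<subseteq> Z \<longrightarrow> Z = M"
  proof (rule subset_Zorn_nonempty)
    show "\<G> \<noteq> {}" using VW unfolding \<G>_def by blast
    fix C assume C: "C \<noteq> {}" "subset.chain \<G> C"
    then have "subset.chain \<F> C" unfolding subset_chain_def \<G>_def by blast
    then have "\<Union>C \<in> C" using C fin Union_in_chain by blast
    then show "\<Union>C \<in> \<G>" using C unfolding subset_chain_def by blast
  qed
  then obtain M where M: "M \<in> \<G>" "\<And>Z. Z \<in> \<G> \<Longrightarrow> M \<subseteq> Z \<Longrightarrow> Z = M" by blast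
  have MW: "M \<in> \<F>" "V \<subseteq> M" "M \<subset> W" using M(1) unfolding \<G>_def by auto
  have "Z = M \<or> Z = W" if "Z \<in> \<F>" "M \<subseteq> Z" "Z \<subseteq> W" for Z
    using that M(2)[of Z] MW(2) unfolding \<G>_def by auto
  then have "covered_in \<F> M W" using MW VW unfolding covered_in_def by auto
  then show thesis using that MW(2) by simp
qed

text \<open>The rank of \<open>V\<close> is the size of a maximal chain in its down-set. Any two
  such chains are completed by one and the same maximal chain above \<open>V\<close>; the
  completions have equal size, hence so have the chains, and the choice does not matter.\<close>

lemma catenary_rank:
  assumes fin: "\<And>C. subset.chain \<F> C \<Longrightarrow> finite C"
    and cat: "\<And>C D. subset.maxchain \<F> C \<Longrightarrow> subset.maxchain \<F> D \<Longrightarrow> card C = card D"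
  shows "\<exists>rk :: 'b set \<Rightarrow> nat. (\<forall>V W. covered_in \<F> V W \<longrightarrow> rk W = Suc (rk V)) \<and>
    (\<forall>V W. V \<in> \<F> \<longrightarrow> W \<in> \<F> \<longrightarrow> V \<subset> W \<longrightarrow> rk V < rk W)"
proof -
  define rk where "rk V = card (SOME C. subset.maxchain {Z \<in> \<F>. Z \<subseteq> V} C)" for V
  have fin': "finite C" if "subset.maxchain {Z \<in> \<F>. P Z} C" for C P
    using that by (intro fin) (auto simp: subset_maxchain_iff subset_chain_def)
  have eq: "rk V = card C" if V: "V \<in> \<F>" and C: "subset.maxchain {Z \<in> \<F>. Z \<subseteq> V} C" for V C
  proof -
    obtain D where D: "subset.maxchain {Z \<in> \<F>. V \<subseteq> Z} D" using subset.Hausdorff by blast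
    have sum: "card E + card D = Suc (card (E \<union> D))"
      and max: "subset.maxchain \<F> (E \<union> D)"
      if E: "subset.maxchain {Z \<in> \<F>. Z \<subseteq> V} E" for E
      using card_Un_Int[OF fin'[OF E] fin'[OF D]] maxchain_join[OF V E D] by auto
    define E where "E = (SOME C. subset.maxchain {Z \<in> \<F>. Z \<subseteq> V} C)"
    have E: "subset.maxchain {Z \<in> \<F>. Z \<subseteq> V} E"
      using someI[where P = "subset.maxchain {Z \<in> \<F>. Z \<subseteq> V}", OF C] unfolding E_def .
    have "card E = card C" using sum[OF E] sum[OF C] cat[OF max[OF E] max[OF C]] by simp
    then show ?thesis unfolding rk_def E_def .
  qed
  have step: "rk W = Suc (rk V)" if VW: "covered_in \<F> V W" for V W
  proof -
    obtain C where C: "subset.maxchain {Z \<in> \<F>. Z \<subseteq> V} C" using subset.Hausdorff by blast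
    have "W \<notin> C" "V \<in> \<F>" "W \<in> \<F>"
      using C VW unfolding covered_in_def subset_maxchain_iff subset_chain_def by blast+
    then show ?thesis
      using eq[OF _ C] eq[OF _ maxchain_insert_cover[OF VW C]] fin'[OF C] by simp
  qed
  have wf: "wf {(Z, Y). Z \<in> \<F> \<and> Y \<in> \<F> \<and> Z \<subset> Y}"
    using fin by (rule finite_chains_no_descent)
  \<comment> \<open>Well-founded descent from \<open>W\<close>: passing to some
    \<open>Z \<supseteq> V\<close> covered by \<open>W\<close> lowers the rank by one, and the
    induction hypothesis compares \<open>V\<close> with \<open>Z\<close>.\<close>
  have "V \<in> \<F> \<longrightarrow> W \<in> \<F> \<longrightarrow> V \<subset> W \<longrightarrow> rk V < rk W" for V W
  proof (induct W rule: wf_induct_rule[OF wf])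
    case (1 W)
    show ?case
    proof (intro impI)
      assume VW: "V \<in> \<F>" "W \<in> \<F>" "V \<subset> W"
      obtain Z where Z: "V \<subseteq> Z" "covered_in \<F> Z W"
        using fin VW by (rule finite_chains_exists_cover)
      have "rk V \<le> rk Z"
        using 1[of Z] Z VW unfolding covered_in_def by (cases "V = Z") auto
      then show "rk V < rk W" using step[OF Z(2)] by simp
    qed
  qed
  then show ?thesis using step by (intro exI[of _ rk]) simp
qed

section \<open>Ideals and primes of subrings\<close>

context cring
begin

lemma subring_minus: "subring W R \<Longrightarrow> x \<in> W \<Longrightarrow> y \<in> W \<Longrightarrow> x \<ominus> y \<in> W"
  unfolding a_minus_def using subringE(5,7) by metis

lemma subring_pow: "subring W R \<Longrightarrow> x \<in> W \<Longrightarrow> x [^] (n::nat) \<in> W"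
  by (induct n) (simp_all add: subringE(3,6))

text \<open>Ideals of the subring \<open>W\<close> are kept as subsets of the ambient ring, so that
  all calculations take place in \<open>R\<close> whichever intermediate ring is involved. Additive
  inverses come from multiplication by \<open>\<ominus> \<one>\<close>.\<close>

definition rel_ideal :: "'a set \<Rightarrow> 'a set \<Rightarrow> bool" where
  "rel_ideal W J \<longleftrightarrow> J \<subseteq> W \<and> \<zero> \<in> J \<and> (\<forall>x\<in>J. \<forall>y\<in>J. x \<oplus> y \<in> J) \<and> (\<forall>x\<in>W. \<forall>y\<in>J. x \<otimes> y \<in> J)"

definition rel_prime :: "'a set \<Rightarrow> 'a set \<Rightarrow> bool" where
  "rel_prime W P \<longleftrightarrow> rel_ideal W P \<and> \<one> \<notin> P \<and> (\<forall>x\<in>W. \<forall>y\<in>W. x \<otimes> y \<in> P \<longrightarrow> x \<in> P \<or> y \<in> P)"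

lemma rel_idealD:
  assumes "subring W R" "rel_ideal W J"
  shows "J \<subseteq> W" "J \<subseteq> carrier R" "\<zero> \<in> J"
    and "\<And>x y. x \<in> J \<Longrightarrow> y \<in> J \<Longrightarrow> x \<oplus> y \<in> J"
    and "\<And>x y. x \<in> W \<Longrightarrow> y \<in> J \<Longrightarrow> x \<otimes> y \<in> J"
    and "\<And>x y. x \<in> J \<Longrightarrow> y \<in> W \<Longrightarrow> x \<otimes> y \<in> J"
    and "\<And>x. x \<in> J \<Longrightarrow> \<ominus> x \<in> J"
    and "\<And>x y. x \<in> J \<Longrightarrow> y \<in> J \<Longrightarrow> x \<ominus> y \<in> J"
proof -
  note W = subringE[OF assms(1)]
  show JW: "J \<subseteq> W" and "\<zero> \<in> J"
    and add: "\<And>x y. x \<in> J \<Longrightarrow> y \<in> J \<Longrightarrow> x \<oplus> y \<in> J"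
    and mult: "\<And>x y. x \<in> W \<Longrightarrow> y \<in> J \<Longrightarrow> x \<otimes> y \<in> J"
    using assms(2) unfolding rel_ideal_def by auto
  then show car: "J \<subseteq> carrier R" using W(1) by blast
  show "x \<otimes> y \<in> J" if "x \<in> J" "y \<in> W" for x y
    using mult[OF that(2,1)] m_comm[OF subsetD[OF car that(1)] subsetD[OF W(1) that(2)]] by simp
  show neg: "\<ominus> x \<in> J" if "x \<in> J" for x
  proof -
    have "\<ominus> \<one> \<otimes> x = \<ominus> x" using that car by (simp add: l_minus subset_iff)
    then show ?thesis using mult[OF W(5)[OF W(3)] that] by simp
  qed
  show "x \<ominus> y \<in> J" if "x \<in> J" "y \<in> J" for x y
    unfolding a_minus_def using add neg that by blast
qed

lemma rel_primeD:
  assumes "rel_prime W P"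
  shows "rel_ideal W P" "\<one> \<notin> P" "\<And>x y. x \<in> W \<Longrightarrow> y \<in> W \<Longrightarrow> x \<otimes> y \<in> P \<Longrightarrow> x \<in> P \<or> y \<in> P"
  using assms unfolding rel_prime_def by auto

lemma rel_prime_pow:
  assumes W: "subring W R" and P: "rel_prime W P" and x: "x \<in> W" "x [^] (n::nat) \<in> P"
  shows "x \<in> P"
  using x(2)
proof (induct n)
  case 0
  then show ?case using rel_primeD(2)[OF P] by simp
next
  case (Suc n)
  then show ?case using rel_primeD(3)[OF P subring_pow[OF W x(1)] x(1)] by auto
qed

lemma rel_prime_Int:
  assumes U: "subring U R" and W: "subring W R" and UW: "U \<subseteq> W" and P: "rel_prime W P"
  shows "rel_prime U (P \<inter> U)"
proof -
  note P' = rel_idealD[OF W rel_primeD(1)[OF P]] and U' = subringE[OF U]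
  have "rel_ideal U (P \<inter> U)"
    unfolding rel_ideal_def using P'(3-5) U'(2,6,7) UW by (simp add: subset_iff)
  then show ?thesis
    unfolding rel_prime_def using rel_primeD(2,3)[OF P] UW by (simp add: subset_iff)
qed

section \<open>Sums of a subring and an ideal\<close>

lemma mem_set_add: "x \<in> A <+>\<^bsub>R\<^esub> B \<longleftrightarrow> (\<exists>a\<in>A. \<exists>b\<in>B. x = a \<oplus> b)"
  unfolding set_add_def' by auto

text \<open>This places \<open>A + J\<close> between \<open>A\<close> and \<open>W\<close>. When
  \<open>A\<close> is a maximal subring of \<open>W\<close> and \<open>J\<close> is not inside
  \<open>A\<close>, it follows that \<open>A + J = W\<close>, which is how covering is exploited
  below.\<close>

lemma subring_add_rel_ideal:
  assumes A: "subring A R" and W: "subring W R" and AW: "A \<subseteq> W" and J: "rel_ideal W J"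
  shows "subring (A <+>\<^bsub>R\<^esub> J) R" "A \<subseteq> A <+>\<^bsub>R\<^esub> J" "J \<subseteq> A <+>\<^bsub>R\<^esub> J" "A <+>\<^bsub>R\<^esub> J \<subseteq> W"
proof -
  note A' = subringE[OF A] and W' = subringE[OF W] and J' = rel_idealD[OF W J]
  have car: "\<And>x. x \<in> A \<Longrightarrow> x \<in> carrier R" "\<And>x. x \<in> J \<Longrightarrow> x \<in> carrier R" using A' J' by auto
  show "A \<subseteq> A <+>\<^bsub>R\<^esub> J"
  proof
    fix x assume "x \<in> A"
    then have "x = x \<oplus> \<zero>" using car by simp
    then show "x \<in> A <+>\<^bsub>R\<^esub> J" using \<open>x \<in> A\<close> J'(3) unfolding mem_set_add by blast
  qed
  show "J \<subseteq> A <+>\<^bsub>R\<^esub> J"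
  proof
    fix x assume "x \<in> J"
    then have "x = \<zero> \<oplus> x" using car by simp
    then show "x \<in> A <+>\<^bsub>R\<^esub> J" using \<open>x \<in> J\<close> A'(2) unfolding mem_set_add by blast
  qed
  show "A <+>\<^bsub>R\<^esub> J \<subseteq> W" using AW J'(1) W'(7) unfolding subset_iff mem_set_add by blast
  then have "A <+>\<^bsub>R\<^esub> J \<subseteq> carrier R" using W'(1) by blast
  then show "subring (A <+>\<^bsub>R\<^esub> J) R"
  proof (rule subringI)
    show "\<one> \<in> A <+>\<^bsub>R\<^esub> J" using A'(3) \<open>A \<subseteq> A <+>\<^bsub>R\<^esub> J\<close> by blast
    show "\<ominus> h \<in> A <+>\<^bsub>R\<^esub> J" if hAJ: "h \<in> A <+>\<^bsub>R\<^esub> J" for h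
    proof -
      obtain a j where h: "a \<in> A" "j \<in> J" "h = a \<oplus> j" using hAJ unfolding mem_set_add by blast
      then have "\<ominus> h = \<ominus> a \<oplus> \<ominus> j" using car by (simp add: minus_add)
      then show ?thesis using A'(5)[OF h(1)] J'(7)[OF h(2)] unfolding mem_set_add by blast
    qed
    fix g h assume "g \<in> A <+>\<^bsub>R\<^esub> J" "h \<in> A <+>\<^bsub>R\<^esub> J"
    then obtain a j b k where *: "a \<in> A" "j \<in> J" "g = a \<oplus> j" "b \<in> A" "k \<in> J" "h = b \<oplus> k"
      unfolding mem_set_add by blast
    then have c: "a \<in> carrier R" "b \<in> carrier R" "j \<in> carrier R" "k \<in> carrier R" using car by auto
    have "g \<otimes> h = a \<otimes> b \<oplus> (a \<otimes> k \<oplus> j \<otimes> b \<oplus> j \<otimes> k)" unfolding * using c by algebra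
    moreover have "a \<otimes> b \<in> A" using A'(6) * by simp
    moreover have "a \<otimes> k \<oplus> j \<otimes> b \<oplus> j \<otimes> k \<in> J"
      using *(1,2,4,5) AW J'(1) by (intro J'(4) J'(5)[OF _ *(5)] J'(6)[OF *(2)]) auto
    ultimately show "g \<otimes> h \<in> A <+>\<^bsub>R\<^esub> J" unfolding mem_set_add by blast
    have "g \<oplus> h = (a \<oplus> b) \<oplus> (j \<oplus> k)" unfolding * using c by algebra
    moreover have "a \<oplus> b \<in> A" "j \<oplus> k \<in> J" using * A'(7) J'(4) by simp_all
    ultimately show "g \<oplus> h \<in> A <+>\<^bsub>R\<^esub> J" unfolding mem_set_add by blast
  qed
qed

lemma rel_ideal_add_principal:
  assumes W: "subring W R" and J: "rel_ideal W J" and x: "x \<in> W"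
  shows "rel_ideal W (J <+>\<^bsub>R\<^esub> ((\<otimes>) x ` W))" "J \<subseteq> J <+>\<^bsub>R\<^esub> ((\<otimes>) x ` W)" "x \<in> J <+>\<^bsub>R\<^esub> ((\<otimes>) x ` W)"
proof -
  note W' = subringE[OF W] and J' = rel_idealD[OF W J]
  have car: "\<And>x. x \<in> W \<Longrightarrow> x \<in> carrier R" "\<And>x. x \<in> J \<Longrightarrow> x \<in> carrier R" using W' J' by auto
  have mem: "z \<in> J <+>\<^bsub>R\<^esub> ((\<otimes>) x ` W) \<longleftrightarrow> (\<exists>j\<in>J. \<exists>s\<in>W. z = j \<oplus> x \<otimes> s)" for z
    unfolding mem_set_add by blast
  have xj: "j \<oplus> x \<otimes> \<zero> = j" if "j \<in> J" for j using that x car by simp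
  have xx: "\<zero> \<oplus> x \<otimes> \<one> = x" using x car by simp
  show "J \<subseteq> J <+>\<^bsub>R\<^esub> ((\<otimes>) x ` W)" using xj W'(2) unfolding subset_iff mem by metis
  show "x \<in> J <+>\<^bsub>R\<^esub> ((\<otimes>) x ` W)" using xx W'(3) J'(3) unfolding mem by metis
  show "rel_ideal W (J <+>\<^bsub>R\<^esub> ((\<otimes>) x ` W))"
    unfolding rel_ideal_def
  proof (intro conjI ballI)
    show "J <+>\<^bsub>R\<^esub> ((\<otimes>) x ` W) \<subseteq> W" using J'(1) W'(6,7) x unfolding subset_iff mem by metis
    show "\<zero> \<in> J <+>\<^bsub>R\<^esub> ((\<otimes>) x ` W)" using xj[OF J'(3)] J'(3) W'(2) unfolding mem by metis
  next
    fix y z assume "y \<in> J <+>\<^bsub>R\<^esub> ((\<otimes>) x ` W)" "z \<in> J <+>\<^bsub>R\<^esub> ((\<otimes>) x ` W)"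
    then obtain j s k t where *: "j \<in> J" "s \<in> W" "y = j \<oplus> x \<otimes> s" "k \<in> J" "t \<in> W" "z = k \<oplus> x \<otimes> t"
      unfolding mem by blast
    then have "j \<in> carrier R" "k \<in> carrier R" "s \<in> carrier R" "t \<in> carrier R" "x \<in> carrier R"
      using car x by auto
    then have "y \<oplus> z = (j \<oplus> k) \<oplus> x \<otimes> (s \<oplus> t)" unfolding * by algebra
    then show "y \<oplus> z \<in> J <+>\<^bsub>R\<^esub> ((\<otimes>) x ` W)" using * J'(4) W'(7) unfolding mem by blast
  next
    fix y z assume y: "y \<in> W" and "z \<in> J <+>\<^bsub>R\<^esub> ((\<otimes>) x ` W)"
    then obtain k t where *: "k \<in> J" "t \<in> W" "z = k \<oplus> x \<otimes> t"
      unfolding mem by blast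
    then have "k \<in> carrier R" "t \<in> carrier R" "x \<in> carrier R" "y \<in> carrier R"
      using car x y by auto
    then have "y \<otimes> z = y \<otimes> k \<oplus> x \<otimes> (y \<otimes> t)" unfolding * by algebra
    then show "y \<otimes> z \<in> J <+>\<^bsub>R\<^esub> ((\<otimes>) x ` W)" using * J'(5) W'(6) y unfolding mem by blast
  qed
qed

section \<open>Lying over\<close>

definition integral_over :: "'a set \<Rightarrow> 'a \<Rightarrow> bool" where
  "integral_over U x \<longleftrightarrow> (\<exists>p. set p \<subseteq> U \<and> eval (\<one> # p) x = \<zero>)"

lemma integral_over_mono: "integral_over U x \<Longrightarrow> U \<subseteq> V \<Longrightarrow> integral_over V x"
  unfolding integral_over_def by blast

section \<open>Congruences modulo an ideal of a subring\<close>

lemma rel_ideal_cong_mult: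
  assumes W: "subring W R" and J: "rel_ideal W J"
    and "a \<in> W" "b \<in> W" "c \<in> W" "d \<in> W" "a \<ominus> b \<in> J" "c \<ominus> d \<in> J"
  shows "a \<otimes> c \<ominus> b \<otimes> d \<in> J"
proof -
  note J' = rel_idealD[OF W J]
  have c: "a \<in> carrier R" "b \<in> carrier R" "c \<in> carrier R" "d \<in> carrier R"
    using assms subringE(1)[OF W] by auto
  have "a \<otimes> c \<ominus> b \<otimes> d = (a \<ominus> b) \<otimes> c \<oplus> b \<otimes> (c \<ominus> d)" using c by algebra
  then show ?thesis using assms J' by simp
qed

lemma rel_ideal_cong_pow:
  assumes W: "subring W R" and J: "rel_ideal W J"
    and "a \<in> W" "b \<in> W" "a \<ominus> b \<in> J"
  shows "a [^] (n::nat) \<ominus> b [^] n \<in> J"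
proof (induct n)
  case 0
  then show ?case using rel_idealD(3)[OF W J] by (simp add: a_minus_def r_neg)
next
  case (Suc n)
  then show ?case using rel_ideal_cong_mult[OF W J _ _ assms(3,4) Suc assms(5)]
    subring_pow[OF W] assms by simp
qed

text \<open>With \<open>n = length p\<close>, a term \<open>c x^i\<close> of \<open>eval p x\<close>
  has \<open>i < n\<close>. Since \<open>a x\<close> is congruent to \<open>w\<close>, multiplying
  it by \<open>a^n\<close> gives \<open>a^(n-i) c w^i\<close> modulo \<open>Q\<close>, and at least
  one factor \<open>a\<close> is left over to put this into \<open>P\<close>.\<close>

lemma scaled_eval_cong:
  assumes U: "subring U R" and W: "subring W R" and UW: "U \<subseteq> W"
    and P: "rel_ideal U P" and Q: "rel_ideal W Q"
    and a: "a \<in> P" and x: "x \<in> W" and w: "w \<in> U" and aw: "a \<otimes> x \<ominus> w \<in> Q"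
    and p: "set p \<subseteq> U"
  shows "\<exists>y\<in>P. a [^] length p \<otimes> eval p x \<ominus> y \<in> Q"
  using p
proof (induct p)
  case Nil
  then show ?case using rel_idealD(3)[OF U P] rel_idealD(3)[OF W Q] by (intro bexI[of _ \<zero>]) (simp_all add: a_minus_def)
next
  case (Cons c p)
  note U' = subringE[OF U] and W' = subringE[OF W]
  note P' = rel_idealD[OF U P] and Q' = rel_idealD[OF W Q]
  obtain y where y: "y \<in> P" "a [^] length p \<otimes> eval p x \<ominus> y \<in> Q" using Cons by auto
  define n where "n = length p"
  have c: "c \<in> U" "set p \<subseteq> U" using Cons(2) by auto
  have car: "a \<in> carrier R" "x \<in> carrier R" "w \<in> carrier R" "c \<in> carrier R" "y \<in> carrier R"
    "eval p x \<in> carrier R" "x [^] n \<in> carrier R" "a [^] n \<in> carrier R" "w [^] n \<in> carrier R"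
    using a x w y c U'(1) W'(1) P'(2) eval_in_carrier[OF subset_trans[OF c(2) U'(1)], of x] by auto
  have pw: "(a \<otimes> x) [^] n \<ominus> w [^] n \<in> Q"
    using rel_ideal_cong_pow[OF W Q _ _ aw] a x w UW P'(1) W'(6) by blast
  have "a [^] length (c # p) \<otimes> eval (c # p) x \<ominus> (a \<otimes> (c \<otimes> w [^] n) \<oplus> a \<otimes> y)
      = (a [^] n \<otimes> a) \<otimes> (c \<otimes> x [^] n \<oplus> eval p x) \<ominus> (a \<otimes> (c \<otimes> w [^] n) \<oplus> a \<otimes> y)"
    unfolding n_def by simp
  also have "\<dots> = (a \<otimes> c) \<otimes> (a [^] n \<otimes> x [^] n \<ominus> w [^] n) \<oplus> a \<otimes> (a [^] n \<otimes> eval p x \<ominus> y)"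
    using car by algebra
  also have "\<dots> = (a \<otimes> c) \<otimes> ((a \<otimes> x) [^] n \<ominus> w [^] n) \<oplus> a \<otimes> (a [^] n \<otimes> eval p x \<ominus> y)"
    using car by (simp add: nat_pow_distrib)
  also have "\<dots> \<in> Q"
    using pw y(2) subsetD[OF UW U'(6)[OF subsetD[OF P'(1) a] c(1)]] subsetD[OF UW subsetD[OF P'(1) a]]
    unfolding n_def by (intro Q'(4,5))
  finally have "a [^] length (c # p) \<otimes> eval (c # p) x \<ominus> (a \<otimes> (c \<otimes> w [^] n) \<oplus> a \<otimes> y) \<in> Q" .
  moreover have "a \<otimes> (c \<otimes> w [^] n) \<oplus> a \<otimes> y \<in> P"
    using a y c w P' U'(6) subring_pow[OF U] by (intro P'(4)) auto
  ultimately show ?case by blast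
qed

text \<open>Take \<open>Q\<close> maximal among the ideals of \<open>W\<close> whose trace on
  \<open>U\<close> lies in \<open>P\<close>. Maximality makes \<open>Q\<close> prime, and
  integrality makes the trace all of \<open>P\<close>.\<close>

lemma lying_over:
  assumes U: "subring U R" and W: "subring W R" and UW: "U \<subseteq> W"
    and int: "\<And>x. x \<in> W \<Longrightarrow> integral_over U x"
    and P: "rel_prime U P"
  obtains Q where "rel_prime W Q" "Q \<inter> U = P"
proof -
  note U' = subringE[OF U] and W' = subringE[OF W]
  note P' = rel_idealD[OF U rel_primeD(1)[OF P]]
  define \<G> where "\<G> = {J. rel_ideal W J \<and> J \<inter> U \<subseteq> P}"
  have "\<exists>Q\<in>\<G>. \<forall>J\<in>\<G>. Q \<subseteq> J \<longrightarrow> J = Q"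
  proof (rule subset_Zorn_nonempty)
    have "rel_ideal W {\<zero>}" using W' unfolding rel_ideal_def by auto
    then have "{\<zero>} \<in> \<G>" using P'(3) unfolding \<G>_def by blast
    then show "\<G> \<noteq> {}" by blast
    fix C assume C: "C \<noteq> {}" "subset.chain \<G> C"
    then have CG: "\<And>J. J \<in> C \<Longrightarrow> rel_ideal W J" "\<And>J. J \<in> C \<Longrightarrow> J \<inter> U \<subseteq> P"
      and tot: "\<And>J K. J \<in> C \<Longrightarrow> K \<in> C \<Longrightarrow> J \<subseteq> K \<or> K \<subseteq> J"
      unfolding subset_chain_def \<G>_def by auto
    note id = rel_idealD[OF W CG(1)]
    have "rel_ideal W (\<Union>C)"
      unfolding rel_ideal_def
    proof (intro conjI ballI)
      show "\<Union>C \<subseteq> W" using id(1) by blast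
      show "\<zero> \<in> \<Union>C" using id(3) C(1) by blast
      show "x \<otimes> y \<in> \<Union>C" if "x \<in> W" "y \<in> \<Union>C" for x y using that id(5) by blast
      fix x y assume "x \<in> \<Union>C" "y \<in> \<Union>C"
      then obtain J K where JK: "J \<in> C" "K \<in> C" "x \<in> J" "y \<in> K" by blast
      then obtain L where "L \<in> C" "x \<in> L" "y \<in> L" using tot[OF JK(1,2)] by blast
      then show "x \<oplus> y \<in> \<Union>C" using id(4) by blast
    qed
    then show "\<Union>C \<in> \<G>" using CG(2) unfolding \<G>_def by blast
  qed
  then obtain Q where "Q \<in> \<G>" and max: "\<And>J. J \<in> \<G> \<Longrightarrow> Q \<subseteq> J \<Longrightarrow> J = Q" by metis
  then have Q: "rel_ideal W Q" and QP: "Q \<inter> U \<subseteq> P" unfolding \<G>_def by auto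
  note Q' = rel_idealD[OF W Q]
  \<comment> \<open>By maximality \<open>Q + x W\<close> meets \<open>U - P\<close>: modulo
    \<open>Q\<close>, every element outside \<open>Q\<close> divides an element of
    \<open>U - P\<close>. Primality of \<open>Q\<close> follows because \<open>U - P\<close> is
    closed under products.\<close>
  have escape: "\<exists>w\<in>U - P. \<exists>s\<in>W. x \<otimes> s \<ominus> w \<in> Q" if x: "x \<in> W" "x \<notin> Q" for x
  proof -
    note J = rel_ideal_add_principal[OF W Q x(1)]
    have "Q <+>\<^bsub>R\<^esub> ((\<otimes>) x ` W) \<noteq> Q" using J(3) x(2) by blast
    then have "Q <+>\<^bsub>R\<^esub> ((\<otimes>) x ` W) \<notin> \<G>" using max[OF _ J(2)] by blast
    then obtain w where w: "w \<in> Q <+>\<^bsub>R\<^esub> ((\<otimes>) x ` W)" "w \<in> U" "w \<notin> P"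
      using J(1) unfolding \<G>_def by blast
    then obtain q s where qs: "q \<in> Q" "s \<in> W" "w = q \<oplus> x \<otimes> s" unfolding mem_set_add by blast
    then have "q \<in> carrier R" "s \<in> carrier R" "x \<in> carrier R" using Q' W' x by auto
    then have "x \<otimes> s \<ominus> w = \<ominus> q" unfolding qs by algebra
    then have "x \<otimes> s \<ominus> w \<in> Q" using Q'(7)[OF qs(1)] by simp
    then show ?thesis using qs(2) w by blast
  qed
  have prime: "rel_prime W Q"
    unfolding rel_prime_def
  proof (intro conjI ballI impI Q)
    show "\<one> \<notin> Q" using rel_primeD(2)[OF P] QP U'(3) by blast
    fix x y assume x: "x \<in> W" and y: "y \<in> W" and xy: "x \<otimes> y \<in> Q"
    show "x \<in> Q \<or> y \<in> Q"
    proof (rule ccontr)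
      assume "\<not> ?thesis"
      then obtain v s w t where *: "v \<in> U" "v \<notin> P" "s \<in> W" "x \<otimes> s \<ominus> v \<in> Q"
        "w \<in> U" "w \<notin> P" "t \<in> W" "y \<otimes> t \<ominus> w \<in> Q"
        using escape[OF x] escape[OF y] by blast
      have c: "v \<in> carrier R" "w \<in> carrier R" "s \<in> carrier R" "t \<in> carrier R" "x \<in> carrier R"
        "y \<in> carrier R" using *(1,3,5,7) x y U'(1) W'(1) by auto
      have 1: "(x \<otimes> s) \<otimes> (y \<otimes> t) \<ominus> v \<otimes> w \<in> Q"
        using * x y UW W'(6) by (intro rel_ideal_cong_mult[OF W Q]) auto
      have 2: "(x \<otimes> y) \<otimes> (s \<otimes> t) \<in> Q" using Q'(6)[OF xy] * W'(6) by blast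
      have "v \<otimes> w = (x \<otimes> y) \<otimes> (s \<otimes> t) \<ominus> ((x \<otimes> s) \<otimes> (y \<otimes> t) \<ominus> v \<otimes> w)" using c by algebra
      then have "v \<otimes> w \<in> Q" using Q'(8)[OF 2 1] by simp
      then have "v \<otimes> w \<in> P" using QP U'(6) * by blast
      then show False using rel_primeD(3)[OF P] * by blast
    qed
  qed
  \<comment> \<open>If \<open>a\<close> in \<open>P\<close> were outside \<open>Q\<close>, then
    \<open>a s\<close> would be congruent to some \<open>w\<close> in \<open>U - P\<close>.
    Multiplying the monic equation of \<open>s\<close> by \<open>a^n\<close> turns its leading term
    into \<open>w^n\<close> and the rest into an element of \<open>P\<close>, modulo
    \<open>Q\<close>; so \<open>w^n\<close>, and with it \<open>w\<close>, would lie in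
    \<open>P\<close>.\<close>
  have "P \<subseteq> Q"
  proof
    fix a assume a: "a \<in> P"
    show "a \<in> Q"
    proof (rule ccontr)
      assume "a \<notin> Q"
      then obtain w s where w: "w \<in> U" "w \<notin> P" "s \<in> W" "a \<otimes> s \<ominus> w \<in> Q"
        using escape[of a] a P'(1) UW by blast
      obtain p where p: "set p \<subseteq> U" "eval (\<one> # p) s = \<zero>"
        using int[OF w(3)] unfolding integral_over_def by blast
      obtain y where y: "y \<in> P" "a [^] length p \<otimes> eval p s \<ominus> y \<in> Q"
        using scaled_eval_cong[OF U W UW rel_primeD(1)[OF P] Q a w(3,1,4) p(1)] by blast
      define n where "n = length p"
      have car: "a \<in> carrier R" "s \<in> carrier R" "w \<in> carrier R" "y \<in> carrier R"
        "eval p s \<in> carrier R" "s [^] n \<in> carrier R" "a [^] n \<in> carrier R" "w [^] n \<in> carrier R"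
        using a w y p U'(1) W'(1) P'(2) eval_in_carrier[OF subset_trans[OF p(1) U'(1)], of s] by auto
      have pw: "(a \<otimes> s) [^] n \<ominus> w [^] n \<in> Q"
        using rel_ideal_cong_pow[OF W Q _ _ w(4)] a w UW P'(1) W'(6) by blast
      have "s [^] n \<oplus> eval p s = \<zero>" using p(2) car unfolding n_def by simp
      then have "a [^] n \<otimes> (s [^] n \<oplus> eval p s) = \<zero>" using car by simp
      then have z: "a [^] n \<otimes> s [^] n \<oplus> a [^] n \<otimes> eval p s = \<zero>" using car by (simp add: r_distr)
      have "w [^] n \<oplus> y = (a [^] n \<otimes> s [^] n \<oplus> a [^] n \<otimes> eval p s)
          \<ominus> ((a [^] n \<otimes> s [^] n \<ominus> w [^] n) \<oplus> (a [^] n \<otimes> eval p s \<ominus> y))"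
        using car by algebra
      also have "\<dots> = \<zero> \<ominus> (((a \<otimes> s) [^] n \<ominus> w [^] n) \<oplus> (a [^] n \<otimes> eval p s \<ominus> y))"
        unfolding z using car by (simp add: nat_pow_distrib)
      also have "\<dots> \<in> Q" using pw y(2) Q'(3,4,8) unfolding n_def by blast
      finally have "w [^] n \<oplus> y \<in> P"
        using QP U'(7) subring_pow[OF U w(1)] y(1) P'(1) by blast
      then have "(w [^] n \<oplus> y) \<ominus> y \<in> P" using y(1) P'(8) by blast
      moreover have "(w [^] n \<oplus> y) \<ominus> y = w [^] n" using car by algebra
      ultimately show False using rel_prime_pow[OF U P w(1)] w(2) by simp
    qed
  qed
  then have "Q \<inter> U = P" using QP P'(1) by blast
  then show thesis using that prime by blast
qed

end

section \<open>Residually surjective extensions\<close>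

context cring
begin

text \<open>Surjectivity of the residual extensions, stated with fractions cleared so that no localization is needed.\<close>

definition residually_onto :: "'a set \<Rightarrow> 'a set \<Rightarrow> bool" where
  "residually_onto U W \<longleftrightarrow>
     (\<forall>Q x. rel_prime W Q \<longrightarrow> x \<in> W \<longrightarrow> (\<exists>t\<in>U. \<exists>v\<in>U. t \<notin> Q \<and> t \<otimes> x \<ominus> v \<in> Q))"

lemma residually_ontoD:
  assumes "residually_onto U W" "rel_prime W Q" "x \<in> W"
  obtains t v where "t \<in> U" "v \<in> U" "t \<notin> Q" "t \<otimes> x \<ominus> v \<in> Q"
  using assms unfolding residually_onto_def by blast

lemma residually_onto_refl:
  assumes W: "subring W R"
  shows "residually_onto W W"
  unfolding residually_onto_def
proof (intro allI impI)
  fix Q x assume Q: "rel_prime W Q" and x: "x \<in> W"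
  have "\<one> \<otimes> x \<ominus> x = \<zero>" using x subringE(1)[OF W] by (auto simp: a_minus_def r_neg)
  then have "\<one> \<otimes> x \<ominus> x \<in> Q" using rel_idealD(3)[OF W rel_primeD(1)[OF Q]] by simp
  then show "\<exists>t\<in>W. \<exists>v\<in>W. t \<notin> Q \<and> t \<otimes> x \<ominus> v \<in> Q"
    using rel_primeD(2)[OF Q] subringE(3)[OF W] x by blast
qed

lemma residually_onto_mono: "residually_onto U W \<Longrightarrow> U \<subseteq> V \<Longrightarrow> residually_onto V W"
  unfolding residually_onto_def by blast

text \<open>Modulo \<open>Q\<close>, \<open>x\<close> is \<open>v / t\<close> over \<open>V\<close>,
  while \<open>t\<close> and \<open>v\<close> are in turn \<open>t' / t1\<close> and
  \<open>v' / v1\<close> over \<open>U\<close>. Hence \<open>x = (t1 v') / (v1 t')\<close>.\<close>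

lemma residually_onto_trans:
  assumes U: "subring U R" and V: "subring V R" and W: "subring W R" and UV: "U \<subseteq> V" and VW: "V \<subseteq> W"
    and 1: "residually_onto U V" and 2: "residually_onto V W"
  shows "residually_onto U W"
  unfolding residually_onto_def
proof (intro allI impI)
  fix Q x assume Q: "rel_prime W Q" and x: "x \<in> W"
  note Q' = rel_idealD[OF W rel_primeD(1)[OF Q]]
  note QV = rel_prime_Int[OF V W VW Q] and W' = subringE[OF W]
  obtain t v where t: "t \<in> V" "v \<in> V" "t \<notin> Q" "t \<otimes> x \<ominus> v \<in> Q"
    using 2 Q x by (rule residually_ontoD)
  obtain t1 t' where t1: "t1 \<in> U" "t' \<in> U" "t1 \<notin> Q \<inter> V" "t1 \<otimes> t \<ominus> t' \<in> Q \<inter> V"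
    using 1 QV t(1) by (rule residually_ontoD)
  obtain v1 v' where v1: "v1 \<in> U" "v' \<in> U" "v1 \<notin> Q \<inter> V" "v1 \<otimes> v \<ominus> v' \<in> Q \<inter> V"
    using 1 QV t(2) by (rule residually_ontoD)
  have inW: "t \<in> W" "v \<in> W" "t1 \<in> W" "t' \<in> W" "v1 \<in> W" "v' \<in> W" using t t1 v1 UV VW by blast+
  have c: "t \<in> carrier R" "v \<in> carrier R" "t1 \<in> carrier R" "t' \<in> carrier R" "v1 \<in> carrier R"
    "v' \<in> carrier R" "x \<in> carrier R" using inW x subringE(1)[OF W] by blast+
  have "t1 \<notin> Q" "v1 \<notin> Q" using t1 v1 UV by blast+
  \<comment> \<open>The new denominator is admissible because \<open>t'\<close> is congruent to
    \<open>t1 t\<close>, a product of elements outside the prime \<open>Q\<close>.\<close>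
  have "t1 \<otimes> t \<notin> Q" using rel_primeD(3)[OF Q inW(3,1)] t(3) \<open>t1 \<notin> Q\<close> by blast
  moreover have "t1 \<otimes> t = (t1 \<otimes> t \<ominus> t') \<oplus> t'" using c by algebra
  ultimately have "t' \<notin> Q" using Q'(4)[of "t1 \<otimes> t \<ominus> t'" t'] t1(4) by auto
  then have "v1 \<otimes> t' \<notin> Q" using rel_primeD(3)[OF Q inW(5,4)] \<open>v1 \<notin> Q\<close> by blast
  moreover have "(v1 \<otimes> t') \<otimes> x \<ominus> t1 \<otimes> v' =
      (v1 \<otimes> t1) \<otimes> (t \<otimes> x \<ominus> v) \<oplus> t1 \<otimes> (v1 \<otimes> v \<ominus> v') \<ominus> (v1 \<otimes> x) \<otimes> (t1 \<otimes> t \<ominus> t')"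
    using c by algebra
  moreover have "\<dots> \<in> Q"
    using Q'(8)[OF Q'(4)[OF Q'(5)[OF W'(6)[OF inW(5,3)] t(4)] Q'(5)[OF inW(3) IntD1[OF v1(4)]]]
        Q'(5)[OF W'(6)[OF inW(5) x] IntD1[OF t1(4)]]] .
  ultimately show "\<exists>t\<in>U. \<exists>v\<in>U. t \<notin> Q \<and> t \<otimes> x \<ominus> v \<in> Q"
    using subringE(6)[OF U] t1(1,2) v1(1,2) by metis
qed

text \<open>By lying over, a prime \<open>P\<close> of \<open>V\<close> is the trace of a prime of
  \<open>W\<close>. For \<open>x\<close> in \<open>V\<close> the element \<open>t x - v\<close>
  found there lies in \<open>V\<close>, hence in \<open>P\<close>.\<close>

lemma residually_onto_restrict:
  assumes U: "subring U R" and V: "subring V R" and W: "subring W R" and UV: "U \<subseteq> V" and VW: "V \<subseteq> W"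
    and int: "\<And>x. x \<in> W \<Longrightarrow> integral_over V x"
    and onto: "residually_onto U W"
  shows "residually_onto U V"
  unfolding residually_onto_def
proof (intro allI impI)
  fix P x assume P: "rel_prime V P" and x: "x \<in> V"
  obtain Q where Q: "rel_prime W Q" "Q \<inter> V = P" using V W VW int P by (rule lying_over)
  obtain t v where t: "t \<in> U" "v \<in> U" "t \<notin> Q" "t \<otimes> x \<ominus> v \<in> Q"
    using onto Q(1) subsetD[OF VW x] by (rule residually_ontoD)
  then have "t \<notin> P" "t \<otimes> x \<ominus> v \<in> P"
    using Q(2) x UV subring_minus[OF V] subringE(6)[OF V] by blast+
  then show "\<exists>t\<in>U. \<exists>v\<in>U. t \<notin> P \<and> t \<otimes> x \<ominus> v \<in> P" using t(1,2) by blast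
qed

section \<open>The conductor of a minimal integral extension\<close>

definition conductor :: "'a set \<Rightarrow> 'a set \<Rightarrow> 'a set" where
  "conductor V W = {w \<in> W. \<forall>y\<in>W. w \<otimes> y \<in> V}"

lemma rel_ideal_conductor:
  assumes V: "subring V R" and W: "subring W R"
  shows "rel_ideal W (conductor V W)"
proof -
  note V' = subringE[OF V] and W' = subringE[OF W]
  have c: "\<And>x. x \<in> W \<Longrightarrow> x \<in> carrier R" using W' by auto
  show ?thesis
    unfolding rel_ideal_def
  proof (intro conjI ballI)
    show "conductor V W \<subseteq> W" unfolding conductor_def by blast
    show "\<zero> \<in> conductor V W" using c V'(2) W'(2) unfolding conductor_def by simp
    show "x \<oplus> y \<in> conductor V W" if "x \<in> conductor V W" "y \<in> conductor V W" for x y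
      using that V'(7) W'(7) c unfolding conductor_def by (auto simp: l_distr)
    fix x y assume x: "x \<in> W" and y: "y \<in> conductor V W"
    then have "y \<in> W" and yV: "\<And>z. z \<in> W \<Longrightarrow> y \<otimes> z \<in> V" unfolding conductor_def by auto
    have "x \<otimes> y \<otimes> z \<in> V" if z: "z \<in> W" for z
    proof -
      have "x \<otimes> y \<otimes> z = y \<otimes> (x \<otimes> z)" using c[OF x] c[OF \<open>y \<in> W\<close>] c[OF z] by algebra
      then show ?thesis using yV W'(6)[OF x z] by simp
    qed
    then show "x \<otimes> y \<in> conductor V W" using W'(6)[OF x \<open>y \<in> W\<close>] unfolding conductor_def by blast
  qed
qed

lemma conductor_subset:
  assumes W: "subring W R"
  shows "conductor V W \<subseteq> V"
proof
  fix x assume "x \<in> conductor V W"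
  then have "x \<otimes> \<one> \<in> V" "x \<in> carrier R" using subringE(1,3)[OF W] unfolding conductor_def by auto
  then show "x \<in> V" by simp
qed

text \<open>The \<open>V\<close>-module spanned by the \<open>k\<close> powers
  \<open>1, ..., x^(k-1)\<close>; \<open>V\<close> itself sits at index \<open>Suc 0\<close>. The
  recursion exposes the coefficient of the highest power, which is the one eliminated in the
  Nakayama argument.\<close>

fun power_span :: "'a set \<Rightarrow> 'a \<Rightarrow> nat \<Rightarrow> 'a set" where
  "power_span V x 0 = {\<zero>}"
| "power_span V x (Suc k) = {c \<otimes> x [^] k \<oplus> g | c g. c \<in> V \<and> g \<in> power_span V x k}"

lemma power_span_closed:
  assumes V: "subring V R" and x: "x \<in> carrier R"
  shows "power_span V x k \<subseteq> carrier R"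
    and "\<zero> \<in> power_span V x k"
    and "g \<in> power_span V x k \<Longrightarrow> h \<in> power_span V x k \<Longrightarrow> g \<oplus> h \<in> power_span V x k"
    and "c \<in> V \<Longrightarrow> g \<in> power_span V x k \<Longrightarrow> c \<otimes> g \<in> power_span V x k"
    and "g \<in> power_span V x k \<Longrightarrow> g \<otimes> x \<in> power_span V x (Suc k)"
proof -
  note V' = subringE[OF V]
  show car: "power_span V x k \<subseteq> carrier R" for k using x V'(1) by (induct k) auto
  show "\<zero> \<in> power_span V x k"
  proof (induct k)
    case (Suc k)
    have "\<zero> = \<zero> \<otimes> x [^] k \<oplus> \<zero>" using x by simp
    then show ?case using Suc V'(2) by force
  qed simp
  show "g \<in> power_span V x k \<Longrightarrow> h \<in> power_span V x k \<Longrightarrow> g \<oplus> h \<in> power_span V x k"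
  proof (induct k arbitrary: g h)
    case (Suc k)
    then obtain c g' d h' where *: "c \<in> V" "g' \<in> power_span V x k" "g = c \<otimes> x [^] k \<oplus> g'"
      "d \<in> V" "h' \<in> power_span V x k" "h = d \<otimes> x [^] k \<oplus> h'" by auto
    have "c \<in> carrier R" "d \<in> carrier R" "g' \<in> carrier R" "h' \<in> carrier R" "x [^] k \<in> carrier R"
      using * V'(1) car x by auto
    then have "g \<oplus> h = (c \<oplus> d) \<otimes> x [^] k \<oplus> (g' \<oplus> h')" unfolding * by algebra
    then show ?case using Suc(1)[OF *(2,5)] V'(7)[OF *(1,4)] by auto
  qed simp
  show "c \<in> V \<Longrightarrow> g \<in> power_span V x k \<Longrightarrow> c \<otimes> g \<in> power_span V x k"
  proof (induct k arbitrary: g)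
    case (Suc k)
    then obtain d g' where *: "d \<in> V" "g' \<in> power_span V x k" "g = d \<otimes> x [^] k \<oplus> g'" by auto
    have "c \<in> carrier R" "d \<in> carrier R" "g' \<in> carrier R" "x [^] k \<in> carrier R"
      using * V'(1) car x Suc(2) by auto
    then have "c \<otimes> g = (c \<otimes> d) \<otimes> x [^] k \<oplus> c \<otimes> g'" unfolding * by algebra
    then show ?case using Suc(1)[OF Suc(2) *(2)] V'(6)[OF Suc(2) *(1)] by auto
  qed (use V'(1) in auto)
  show "g \<in> power_span V x k \<Longrightarrow> g \<otimes> x \<in> power_span V x (Suc k)"
  proof (induct k arbitrary: g)
    case 0
    then show ?case using V'(2) x by (auto intro!: exI[of _ \<zero>])
  next
    case (Suc k)
    then obtain d g' where *: "d \<in> V" "g' \<in> power_span V x k" "g = d \<otimes> x [^] k \<oplus> g'" by auto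
    have "d \<in> carrier R" "g' \<in> carrier R" "x [^] k \<in> carrier R" using * V'(1) car x by auto
    then have "g \<otimes> x = d \<otimes> (x [^] k \<otimes> x) \<oplus> g' \<otimes> x" unfolding * using x by algebra
    then have "g \<otimes> x = d \<otimes> x [^] Suc k \<oplus> g' \<otimes> x" by simp
    then show ?case using Suc(1)[OF *(2)] *(1) unfolding power_span.simps(2)[of V x "Suc k"] by blast
  qed
qed

lemma power_span_Suc_mono:
  assumes V: "subring V R" and x: "x \<in> carrier R"
  shows "power_span V x k \<subseteq> power_span V x (Suc k)"
proof
  fix g assume g: "g \<in> power_span V x k"
  have "g \<in> carrier R" using g power_span_closed(1)[OF V x] by blast
  then have "g = \<zero> \<otimes> x [^] k \<oplus> g" using x by simp
  then show "g \<in> power_span V x (Suc k)" using g subringE(2)[OF V] by auto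
qed

lemma power_span_one:
  assumes V: "subring V R"
  shows "power_span V x (Suc 0) = V"
proof -
  have "c \<otimes> x [^] (0::nat) \<oplus> \<zero> = c" if "c \<in> V" for c using that subringE(1)[OF V] by auto
  then show ?thesis by force
qed

lemma subset_power_span:
  assumes V: "subring V R" and x: "x \<in> carrier R"
  shows "V \<subseteq> power_span V x (Suc k)"
proof (induct k)
  case 0
  show ?case unfolding power_span_one[OF V] by simp
next
  case (Suc k)
  then show ?case using power_span_Suc_mono[OF V x, of "Suc k"] by blast
qed

lemma eval_in_power_span:
  assumes V: "subring V R" and p: "set p \<subseteq> V"
  shows "eval p x \<in> power_span V x (length p)"
  using p by (induct p) auto

text \<open>A monic equation of degree \<open>m\<close> expresses \<open>x^m\<close> by lower
  powers, so the span is stable under multiplication by \<open>x\<close> and therefore a ring. One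
  power more than necessary is kept: the index \<open>Suc m\<close> fits
  \<open>subset_power_span\<close> even for \<open>m = 0\<close>.\<close>

lemma subring_power_span:
  assumes V: "subring V R" and x: "x \<in> carrier R" and int: "integral_over V x"
  obtains m where "subring (power_span V x (Suc m)) R" "x \<in> power_span V x (Suc m)"
proof -
  note V' = subringE[OF V]
  note cl = power_span_closed[OF V x]
  obtain p where p: "set p \<subseteq> V" "eval (\<one> # p) x = \<zero>" using int unfolding integral_over_def by blast
  define m where "m = length p"
  let ?S = "power_span V x (Suc m)"
  have ev: "eval p x \<in> carrier R" using eval_in_carrier p(1) V'(1) x by blast
  have "x [^] m \<oplus> eval p x = \<zero>" using p(2) x ev unfolding m_def by simp
  then have "x [^] m = \<ominus> eval p x" using x ev by (simp add: sum_zero_eq_neg)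
  also have "\<dots> = (\<ominus> \<one>) \<otimes> eval p x" using ev by (simp add: l_minus)
  also have "\<dots> \<in> power_span V x m"
    unfolding m_def by (rule cl(4)[OF V'(5)[OF V'(3)] eval_in_power_span[OF V p(1)]])
  finally have "x [^] m \<otimes> x \<in> ?S" by (rule cl(5))
  then have xm: "x [^] Suc m \<in> ?S" by simp
  have mx: "g \<otimes> x \<in> ?S" if g: "g \<in> ?S" for g
  proof -
    obtain c g' where *: "c \<in> V" "g' \<in> power_span V x m" "g = c \<otimes> x [^] m \<oplus> g'" using g by auto
    have "c \<in> carrier R" "g' \<in> carrier R" "x [^] m \<in> carrier R" using * V'(1) cl(1) x by auto
    then have "g \<otimes> x = c \<otimes> (x [^] m \<otimes> x) \<oplus> g' \<otimes> x" unfolding * using x by algebra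
    then have "g \<otimes> x = c \<otimes> x [^] Suc m \<oplus> g' \<otimes> x" by simp
    then show ?thesis using cl(3)[OF cl(4)[OF *(1) xm] cl(5)[OF *(2)]] by simp
  qed
  have mpow: "x [^] (i::nat) \<otimes> g \<in> ?S" if g: "g \<in> ?S" for g i
  proof (induct i)
    case 0
    have "g \<in> carrier R" using g cl(1) by blast
    then show ?case using g by simp
  next
    case (Suc i)
    have "g \<in> carrier R" "x [^] i \<in> carrier R" using subsetD[OF cl(1) g] x by simp_all
    then have "x [^] i \<otimes> x \<otimes> g = x [^] i \<otimes> g \<otimes> x" using x by algebra
    then show ?case using mx[OF Suc] by simp
  qed
  have mult: "h \<otimes> g \<in> ?S" if g: "g \<in> ?S" and h: "h \<in> power_span V x k" for g h k
    using h
  proof (induct k arbitrary: h)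
    case 0
    have "g \<in> carrier R" using g cl(1) by blast
    then show ?case using 0 cl(2)[of "Suc m"] by (simp del: power_span.simps(2))
  next
    case (Suc k)
    then obtain c h' where *: "c \<in> V" "h' \<in> power_span V x k" "h = c \<otimes> x [^] k \<oplus> h'" by auto
    have "c \<in> carrier R" "h' \<in> carrier R" "x [^] k \<in> carrier R" "g \<in> carrier R"
      using subsetD[OF V'(1) *(1)] subsetD[OF cl(1) *(2)] x subsetD[OF cl(1) g] by simp_all
    then have "h \<otimes> g = c \<otimes> (x [^] k \<otimes> g) \<oplus> h' \<otimes> g" unfolding * by algebra
    then show ?case using cl(3)[OF cl(4)[OF *(1) mpow[OF g]] Suc(1)[OF *(2)]] by simp
  qed
  have VS: "V \<subseteq> ?S" by (rule subset_power_span[OF V x])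
  have one: "\<one> \<in> ?S" using VS V'(3) by blast
  have "subring ?S R"
  proof (rule subringI[OF cl(1) one _ mult cl(3)])
    fix h assume h: "h \<in> ?S"
    then have "h \<in> carrier R" using cl(1) by blast
    then have "\<ominus> h = (\<ominus> \<one>) \<otimes> h" by (simp add: l_minus)
    then show "\<ominus> h \<in> ?S" using cl(4)[OF V'(5)[OF V'(3)] h] by simp
  qed
  moreover have "x \<in> ?S" using mx[OF one] x by simp
  ultimately show thesis using that by blast
qed

text \<open>A subring containing \<open>V\<close> contains \<open>B\<close>, so maximality of
  \<open>V\<close> in \<open>W\<close> may be tested against all subrings of the ambient
  ring.\<close>

lemma covered_subringD:
  assumes "covered_in (intermediate_rings R B) V W"
  shows "subring V R" "subring W R" "B \<subseteq> V" "V \<subset> W"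
    and "\<And>Y. subring Y R \<Longrightarrow> V \<subseteq> Y \<Longrightarrow> Y \<subseteq> W \<Longrightarrow> Y = V \<or> Y = W"
proof -
  show "subring V R" "subring W R" and B: "B \<subseteq> V" and "V \<subset> W"
    using assms unfolding covered_in_def intermediate_rings_def by auto
  show "Y = V \<or> Y = W" if "subring Y R" "V \<subseteq> Y" "Y \<subseteq> W" for Y
    using assms that subset_trans[OF B that(2)] unfolding covered_in_def intermediate_rings_def by simp
qed

text \<open>Nakayama's lemma for the module \<open>W/V\<close>, which \<open>a\<close> maps onto itself: the generators \<open>x\<^sup>k\<close> are
  eliminated one at a time.\<close>

lemma conductor_maximal:
  assumes cov: "covered_in (intermediate_rings R B) V W"
    and int: "\<And>x. x \<in> W \<Longrightarrow> integral_over V x"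
    and a: "a \<in> V" "a \<notin> conductor V W"
  obtains b where "b \<in> V" "a \<otimes> b \<ominus> \<one> \<in> conductor V W"
proof -
  note VW = covered_subringD[OF cov]
  note V' = subringE[OF VW(1)] and W' = subringE[OF VW(2)]
  note M = rel_ideal_conductor[OF VW(1,2)] and MV = conductor_subset[OF VW(2), of V]
  have aW: "a \<in> W" using a VW(4) by blast
  obtain x where x: "x \<in> W" "x \<notin> V" using VW(4) by blast
  have xc: "x \<in> carrier R" using x W'(1) by blast
  note cl = power_span_closed[OF VW(1) xc]
  obtain m where m: "subring (power_span V x (Suc m)) R" "x \<in> power_span V x (Suc m)"
    using VW(1) xc int[OF x(1)] by (rule subring_power_span)
  \<comment> \<open>Intersecting the ring \<open>V[x]\<close> with \<open>W\<close> gives a subring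
    that is strictly larger than \<open>V\<close>, hence all of \<open>W\<close>.\<close>
  have WS: "W \<subseteq> power_span V x (Suc m)"
  proof -
    let ?S = "power_span V x (Suc m)"
    have "V \<subseteq> W \<inter> ?S" "subring (W \<inter> ?S) R"
      using VW(4) subset_power_span[OF VW(1) xc] subring_inter[OF VW(2) m(1)] by blast+
    then show ?thesis using VW(5)[of "W \<inter> ?S"] x m(2) by blast
  qed
  \<comment> \<open>This is \<open>W = V + a W\<close>. As \<open>a\<close> is not in the conductor,
    the ideal generated by \<open>a\<close> and the conductor leaves \<open>V\<close>, so its sum
    with \<open>V\<close> is \<open>W\<close>; the conductor part is absorbed by
    \<open>V\<close>.\<close>
  have dec: "\<exists>v\<in>V. \<exists>s\<in>W. y = v \<oplus> a \<otimes> s" if y: "y \<in> W" for y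
  proof -
    let ?J = "conductor V W <+>\<^bsub>R\<^esub> ((\<otimes>) a ` W)"
    note J = rel_ideal_add_principal[OF VW(2) M aW]
    note S = subring_add_rel_ideal[OF VW(1,2) psubset_imp_subset[OF VW(4)] J(1)]
    obtain z where z: "z \<in> W" "a \<otimes> z \<notin> V" using a aW unfolding conductor_def by blast
    have "a \<otimes> z \<in> ?J" using rel_idealD(6)[OF VW(2) J(1) J(3) z(1)] .
    then have "V <+>\<^bsub>R\<^esub> ?J = W" using VW(5)[OF S(1,2,4)] S(3) z(2) by blast
    then have "y \<in> V <+>\<^bsub>R\<^esub> ?J" using y by simp
    from iffD1[OF mem_set_add this] obtain v j where v: "v \<in> V" "j \<in> ?J" "y = v \<oplus> j" by blast
    from iffD1[OF mem_set_add v(2)] obtain c s where "c \<in> conductor V W" "s \<in> W" "j = c \<oplus> a \<otimes> s"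
      by blast
    then have *: "v \<in> V" "c \<in> conductor V W" "s \<in> W" "y = v \<oplus> (c \<oplus> a \<otimes> s)" using v by simp_all
    have "v \<in> carrier R" "c \<in> carrier R" "s \<in> carrier R" "a \<in> carrier R"
      using * V'(1) W'(1) MV a(1) by blast+
    then have "y = (v \<oplus> c) \<oplus> a \<otimes> s" unfolding * by algebra
    then show ?thesis using V'(7)[OF *(1) subsetD[OF MV *(2)]] *(3) by blast
  qed
  \<comment> \<open>\<open>good k\<close> says that some \<open>1 - a b\<close> maps
    \<open>W\<close> into the span of \<open>1, ..., x^k\<close>. At \<open>k = m\<close> the choice
    \<open>b = 0\<close> works; at \<open>k = 0\<close> the target is \<open>V\<close>, so
    \<open>1 - a b\<close> lies in the conductor.\<close>
  define good where "good k \<longleftrightarrow> (\<exists>b\<in>V. \<forall>y\<in>W. (\<one> \<ominus> a \<otimes> b) \<otimes> y \<in> power_span V x (Suc k))" for k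
  have step: "good k" if good: "good (Suc k)" for k
  proof -
    let ?S = "power_span V x (Suc k)"
    let ?z = "x [^] Suc k"
    obtain b where b: "b \<in> V" and bS: "\<And>y. y \<in> W \<Longrightarrow> (\<one> \<ominus> a \<otimes> b) \<otimes> y \<in> power_span V x (Suc (Suc k))"
      using good unfolding good_def by blast
    define c where "c = \<one> \<ominus> a \<otimes> b"
    have c: "c \<in> V" unfolding c_def using subring_minus[OF VW(1) V'(3)] V'(6)[OF a(1) b] by blast
    obtain v s where vs: "v \<in> V" "s \<in> W" "?z = v \<oplus> a \<otimes> s"
      using dec[of ?z] subring_pow[OF VW(2) x(1)] by blast
    obtain d g where dg: "d \<in> V" "g \<in> ?S" "c \<otimes> s = d \<otimes> ?z \<oplus> g"
      using bS[OF vs(2)] unfolding c_def power_span.simps(2)[of V x "Suc k"] by blast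
    have car: "a \<in> carrier R" "b \<in> carrier R" "c \<in> carrier R" "v \<in> carrier R" "s \<in> carrier R"
      "d \<in> carrier R" "g \<in> carrier R" "?z \<in> carrier R"
      using V'(1) W'(1) a(1) b c vs(1,2) dg(1) subsetD[OF cl(1) dg(2)] xc by auto
    \<comment> \<open>Modulo the span of lower powers, \<open>c z\<close> equals
      \<open>a d z\<close> for \<open>z = x^(k+1)\<close>. Hence \<open>c - a d\<close> sends the
      top power \<open>z\<close> into that span.\<close>
    define e where "e = c \<ominus> a \<otimes> d"
    have e: "e \<in> V" unfolding e_def using subring_minus[OF VW(1) c] V'(6)[OF a(1) dg(1)] by blast
    have ec: "e \<in> carrier R" using e V'(1) by blast
    have "c \<otimes> ?z = c \<otimes> (v \<oplus> a \<otimes> s)" using vs(3) by simp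
    also have "\<dots> = c \<otimes> v \<oplus> a \<otimes> (c \<otimes> s)" using car by algebra
    also have "\<dots> = c \<otimes> v \<oplus> a \<otimes> (d \<otimes> ?z \<oplus> g)" unfolding dg ..
    finally have cz: "c \<otimes> ?z = c \<otimes> v \<oplus> a \<otimes> (d \<otimes> ?z \<oplus> g)" .
    have "e \<otimes> ?z = c \<otimes> ?z \<ominus> a \<otimes> (d \<otimes> ?z)" unfolding e_def using car by algebra
    also have "\<dots> = c \<otimes> v \<oplus> a \<otimes> g" unfolding cz using car by algebra
    also have "\<dots> \<in> ?S"
      using cl(3)[OF subsetD[OF subset_power_span[OF VW(1) xc] V'(6)[OF c vs(1)]] cl(4)[OF a(1) dg(2)]] .
    finally have ez: "e \<otimes> ?z \<in> ?S" .
    have "(e \<otimes> c) \<otimes> y \<in> ?S" if y: "y \<in> W" for y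
    proof -
      obtain f h where fh: "f \<in> V" "h \<in> ?S" "c \<otimes> y = f \<otimes> ?z \<oplus> h"
        using bS[OF y] unfolding c_def power_span.simps(2)[of V x "Suc k"] by blast
      have fc: "f \<in> carrier R" "h \<in> carrier R" "y \<in> carrier R" using subsetD[OF V'(1) fh(1)] subsetD[OF cl(1) fh(2)] subsetD[OF W'(1) y] by simp_all
      have "(e \<otimes> c) \<otimes> y = e \<otimes> (c \<otimes> y)" using ec car(3) fc(3) by (rule m_assoc)
      also have "\<dots> = f \<otimes> (e \<otimes> ?z) \<oplus> e \<otimes> h" unfolding fh(3) using ec fc car(8) by algebra
      also have "\<dots> \<in> ?S" using cl(3)[OF cl(4)[OF fh(1) ez] cl(4)[OF e fh(2)]] .
      finally show ?thesis .
    qed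
    \<comment> \<open>The product of two elements of the form \<open>1 - a b\<close> has this form
      again, so the elimination can be repeated.\<close>
    moreover have "e \<otimes> c = \<one> \<ominus> a \<otimes> (b \<oplus> d \<oplus> b \<ominus> a \<otimes> (b \<oplus> d) \<otimes> b)"
      unfolding e_def c_def using car(1,2,6) by algebra
    moreover have "b \<oplus> d \<oplus> b \<ominus> a \<otimes> (b \<oplus> d) \<otimes> b \<in> V"
      using a(1) b dg(1) by (intro subring_minus[OF VW(1)] V'(6,7))
    ultimately show ?thesis unfolding good_def by auto
  qed
  have "good m"
    unfolding good_def
  proof (intro bexI ballI)
    fix y assume "y \<in> W"
    moreover have "(\<one> \<ominus> a \<otimes> \<zero>) \<otimes> y = y" using subsetD[OF W'(1) \<open>y \<in> W\<close>] subsetD[OF W'(1) aW]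
      by (simp add: a_minus_def)
    ultimately show "(\<one> \<ominus> a \<otimes> \<zero>) \<otimes> y \<in> power_span V x (Suc m)" using WS by auto
  qed (rule V'(2))
  then have "good 0" by (induct m) (use step in blast)+
  then obtain b where b: "b \<in> V" "\<And>y. y \<in> W \<Longrightarrow> (\<one> \<ominus> a \<otimes> b) \<otimes> y \<in> V"
    unfolding good_def power_span_one[OF VW(1)] by blast
  have "\<one> \<ominus> a \<otimes> b \<in> W"
    using subring_minus[OF VW(1) V'(3)] V'(6)[OF a(1) b(1)] VW(4) by blast
  then have M1: "\<one> \<ominus> a \<otimes> b \<in> conductor V W" using b(2) unfolding conductor_def by blast
  have "a \<in> carrier R" "b \<in> carrier R" using a b V'(1) by blast+
  then have "a \<otimes> b \<ominus> \<one> = \<ominus> (\<one> \<ominus> a \<otimes> b)" by algebra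
  then show thesis using that b(1) rel_idealD(7)[OF VW(2) M M1] by simp
qed

end

section \<open>Graded integral extensions\<close>

text \<open>Here the catenarian hypothesis is replaced by a rank that rises by exactly one along
  each cover, which allows lengths of intervals to be compared by arithmetic.\<close>

locale graded_integral_extension = cring R for R (structure) +
  fixes B :: "'a set" and rk :: "'a set \<Rightarrow> nat"
  assumes base_integral: "\<And>x. x \<in> carrier R \<Longrightarrow> integral_over B x"
    and finite_chains: "\<And>C. subset.chain (intermediate_rings R B) C \<Longrightarrow> finite C"
    and rk_cover: "\<And>V W. covered_in (intermediate_rings R B) V W \<Longrightarrow> rk W = Suc (rk V)"
    and rk_mono: "\<And>V W. V \<in> intermediate_rings R B \<Longrightarrow> W \<in> intermediate_rings R B \<Longrightarrow> V \<subset> W \<Longrightarrow> rk V < rk W"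
begin

abbreviation \<F> where "\<F> \<equiv> intermediate_rings R B"

lemma mem_intermediate: "V \<in> \<F> \<longleftrightarrow> subring V R \<and> B \<subseteq> V"
  unfolding intermediate_rings_def by simp

lemma intermediate_integral: "B \<subseteq> V \<Longrightarrow> subring W R \<Longrightarrow> x \<in> W \<Longrightarrow> integral_over V x"
  using base_integral integral_over_mono subringE(1) by blast

lemma covered_mem: "covered_in \<F> V W \<Longrightarrow> V \<in> \<F>" "covered_in \<F> V W \<Longrightarrow> W \<in> \<F>"
  unfolding covered_in_def by auto

section \<open>Arithmetic modulo the conductor of a cover\<close>

lemma conductor_inverse:
  assumes cov: "covered_in \<F> V W" and a: "a \<in> V" "a \<notin> conductor V W"
  obtains b where "b \<in> V" "a \<otimes> b \<ominus> \<one> \<in> conductor V W"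
  using cov intermediate_integral[OF covered_subringD(3,2)[OF cov]] a by (rule conductor_maximal)

text \<open>If \<open>b\<close> inverts \<open>a\<close> modulo the conductor, then
  \<open>y = b (a y) - y (a b - 1)\<close>. The conductor is an ideal of \<open>W\<close>, so
  \<open>y\<close> may range over \<open>W\<close> and not only over \<open>V\<close>.\<close>

lemma cancel_mod_conductor:
  assumes cov: "covered_in \<F> V W" and a: "a \<in> V" "a \<notin> conductor V W"
    and y: "y \<in> W" "a \<otimes> y \<in> conductor V W"
  shows "y \<in> conductor V W"
proof -
  note VW = covered_subringD[OF cov]
  note M' = rel_idealD[OF VW(2) rel_ideal_conductor[OF VW(1,2)]]
  obtain b where b: "b \<in> V" "a \<otimes> b \<ominus> \<one> \<in> conductor V W" using cov a by (rule conductor_inverse)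
  have inW: "a \<in> W" "b \<in> W" using a b VW(4) by blast+
  then have "a \<in> carrier R" "b \<in> carrier R" "y \<in> carrier R" using y subringE(1)[OF VW(2)] by blast+
  then have "y = b \<otimes> (a \<otimes> y) \<ominus> y \<otimes> (a \<otimes> b \<ominus> \<one>)" by algebra
  then show ?thesis using M'(8)[OF M'(5)[OF inW(2) y(2)] M'(5)[OF y(1) b(2)]] by simp
qed

lemma conductor_prime:
  assumes cov: "covered_in \<F> V W"
  shows "rel_prime V (conductor V W)"
proof -
  note VW = covered_subringD[OF cov]
  note M' = rel_idealD[OF VW(2) rel_ideal_conductor[OF VW(1,2)]]
  have V: "\<And>x. x \<in> V \<Longrightarrow> x \<in> W" using VW(4) by blast
  have "rel_ideal V (conductor V W)"
    using conductor_subset[OF VW(2)] M'(3-5) V unfolding rel_ideal_def by simp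
  moreover have "\<one> \<notin> conductor V W"
  proof
    assume "\<one> \<in> conductor V W"
    then have "\<one> \<otimes> y \<in> V" if "y \<in> W" for y using that unfolding conductor_def by blast
    then have "W \<subseteq> V" using subringE(1)[OF VW(2)] by fastforce
    then show False using VW(4) by blast
  qed
  ultimately show ?thesis
    using cancel_mod_conductor[OF cov] V unfolding rel_prime_def by blast
qed

text \<open>A prime \<open>Q\<close> over the conductor exists by lying over. Residual surjectivity
  writes \<open>w\<close> as \<open>v / t\<close> modulo \<open>Q\<close>, and \<open>t\<close> is
  invertible modulo the conductor, so no denominator remains: \<open>W = V + Q\<close>.\<close>

lemma prime_complement:
  assumes cov: "covered_in \<F> V W" and onto: "residually_onto V W"
  obtains Q where "rel_prime W Q" "Q \<inter> V = conductor V W" "\<And>w. w \<in> W \<Longrightarrow> \<exists>v\<in>V. w \<ominus> v \<in> Q"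
proof -
  note VW = covered_subringD[OF cov]
  note V' = subringE[OF VW(1)] and W' = subringE[OF VW(2)]
  obtain Q where Q: "rel_prime W Q" "Q \<inter> V = conductor V W"
    using VW(1,2) psubset_imp_subset[OF VW(4)] intermediate_integral[OF VW(3,2)] conductor_prime[OF cov]
    by (rule lying_over)
  note Q' = rel_idealD[OF VW(2) rel_primeD(1)[OF Q(1)]]
  have "\<exists>v\<in>V. w \<ominus> v \<in> Q" if w: "w \<in> W" for w
  proof -
    obtain t v where t: "t \<in> V" "v \<in> V" "t \<notin> Q" "t \<otimes> w \<ominus> v \<in> Q"
      using onto Q(1) w by (rule residually_ontoD)
    then have "t \<notin> conductor V W" using Q(2) by blast
    with cov t(1) obtain b where b: "b \<in> V" "t \<otimes> b \<ominus> \<one> \<in> conductor V W" by (rule conductor_inverse)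
    then have bQ: "t \<otimes> b \<ominus> \<one> \<in> Q" using Q(2) by blast
    have c: "t \<in> carrier R" "v \<in> carrier R" "b \<in> carrier R" "w \<in> carrier R"
      using t(1,2) b(1) w V'(1) W'(1) by blast+
    have "w \<ominus> b \<otimes> v = b \<otimes> (t \<otimes> w \<ominus> v) \<ominus> w \<otimes> (t \<otimes> b \<ominus> \<one>)" using c by algebra
    moreover have "\<dots> \<in> Q" using Q'(8)[OF Q'(5)[OF _ t(4)] Q'(5)[OF w bQ]] b(1) VW(4) by blast
    ultimately have "w \<ominus> b \<otimes> v \<in> Q" by simp
    then show ?thesis using V'(6)[OF b(1) t(2)] by blast
  qed
  then show thesis using that Q by blast
qed

text \<open>By the modular law, adding the complement \<open>Q\<close> of \<open>V\<close> identifies the interval between \<open>T\<close> and \<open>V\<close>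
  with the one between \<open>T + Q\<close> and \<open>W\<close>.\<close>

lemma rank_shift:
  assumes cov: "covered_in \<F> V W" and Q: "rel_ideal W Q" "Q \<inter> V = conductor V W"
    and compl: "\<And>w. w \<in> W \<Longrightarrow> \<exists>v\<in>V. w \<ominus> v \<in> Q"
    and T: "T \<in> \<F>" "conductor V W \<subseteq> T" "T \<subseteq> V"
  shows "rk V + rk (T <+>\<^bsub>R\<^esub> Q) = rk W + rk T"
proof -
  note VW = covered_subringD[OF cov]
  note V' = subringE[OF VW(1)] and W' = subringE[OF VW(2)] and Q' = rel_idealD[OF VW(2) Q(1)]
  have sum: "subring (Y <+>\<^bsub>R\<^esub> Q) R" "Y \<subseteq> Y <+>\<^bsub>R\<^esub> Q" "Q \<subseteq> Y <+>\<^bsub>R\<^esub> Q" "Y <+>\<^bsub>R\<^esub> Q \<subseteq> W"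
    if "subring Y R" "Y \<subseteq> V" for Y
    using subring_add_rel_ideal[OF that(1) VW(2) _ Q(1)] that(2) VW(4) by blast+
  \<comment> \<open>The two halves of the modular law: \<open>trace\<close> recovers
    \<open>Y\<close> from \<open>Y + Q\<close> by intersecting with \<open>V\<close>, and
    \<open>split\<close> recovers \<open>Z \<supseteq> Q\<close> from \<open>Z \<inter> V\<close> by
    adding \<open>Q\<close>.\<close>
  have trace: "(Y <+>\<^bsub>R\<^esub> Q) \<inter> V \<subseteq> Y" if Y: "subring Y R" "conductor V W \<subseteq> Y" "Y \<subseteq> V" for Y
  proof
    fix z assume z: "z \<in> (Y <+>\<^bsub>R\<^esub> Q) \<inter> V"
    then obtain y q where yq: "y \<in> Y" "q \<in> Q" "z = y \<oplus> q" using iffD1[OF mem_set_add] by blast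
    have c: "y \<in> carrier R" "q \<in> carrier R" using yq Y(3) V'(1) Q'(2) by blast+
    have "q = z \<ominus> y" unfolding yq using c by algebra
    then have "q \<in> V" using subring_minus[OF VW(1), of z y] z yq(1) Y(3) by blast
    then have "q \<in> Y" using yq(2) Q(2) Y(2) by blast
    then show "z \<in> Y" using yq subringE(7)[OF Y(1)] by blast
  qed
  have split: "Z \<subseteq> (Z \<inter> V) <+>\<^bsub>R\<^esub> Q" if Z: "subring Z R" "Q \<subseteq> Z" "Z \<subseteq> W" for Z
  proof
    fix z assume z: "z \<in> Z"
    obtain v where v: "v \<in> V" "z \<ominus> v \<in> Q" using compl z Z(3) by blast
    have c: "z \<in> carrier R" "v \<in> carrier R" using z v(1) V'(1) Z(3) W'(1) by blast+
    have "v = z \<ominus> (z \<ominus> v)" using c by algebra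
    then have "v \<in> Z" using subring_minus[OF Z(1) z] v(2) Z(2) by fastforce
    moreover have "z = v \<oplus> (z \<ominus> v)" using c by algebra
    ultimately show "z \<in> (Z \<inter> V) <+>\<^bsub>R\<^esub> Q" using v unfolding mem_set_add by blast
  qed
  \<comment> \<open>The equality of the two rank differences is stated additively to avoid truncated
    subtraction. The induction moves \<open>Y\<close> down to \<open>T\<close> one cover at a
    time.\<close>
  have shift: "rk Y + rk (T <+>\<^bsub>R\<^esub> Q) = rk (Y <+>\<^bsub>R\<^esub> Q) + rk T" if "Y \<in> \<F>" "T \<subseteq> Y" "Y \<subseteq> V" for Y
    using that
  proof (induct "rk Y" arbitrary: Y rule: less_induct)
    case less
    show ?case
    proof (cases "Y = T")
      case False
      then have "T \<subset> Y" using less(3) by blast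
      with finite_chains T(1) less(2) obtain Z where Z: "T \<subseteq> Z" "covered_in \<F> Z Y"
        by (rule finite_chains_exists_cover)
      note ZY = covered_subringD[OF Z(2)]
      have ZV: "Z \<subseteq> V" using ZY(4) less(4) by blast
      note SZ = sum[OF ZY(1) ZV] and SY = sum[OF ZY(2) less(4)]
      have IH: "rk Z + rk (T <+>\<^bsub>R\<^esub> Q) = rk (Z <+>\<^bsub>R\<^esub> Q) + rk T"
        using less(1)[OF _ covered_mem(1)[OF Z(2)] Z(1) ZV] rk_cover[OF Z(2)] by simp
      have trY: "(Y <+>\<^bsub>R\<^esub> Q) \<inter> V = Y" and trZ: "(Z <+>\<^bsub>R\<^esub> Q) \<inter> V = Z"
        using trace[OF ZY(2) _ less(4)] trace[OF ZY(1) _ ZV] T(2) Z(1) less(3,4) ZV SY(2) SZ(2) by blast+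
      \<comment> \<open>For \<open>A\<close> between the two sums, \<open>A \<inter> V\<close> lies
        between \<open>Z\<close> and \<open>Y\<close>, hence is one of them, and
        \<open>A = (A \<inter> V) + Q\<close>.\<close>
      have "covered_in \<F> (Z <+>\<^bsub>R\<^esub> Q) (Y <+>\<^bsub>R\<^esub> Q)"
        unfolding covered_in_def
      proof (intro conjI ballI impI)
        show "Z <+>\<^bsub>R\<^esub> Q \<in> \<F>" "Y <+>\<^bsub>R\<^esub> Q \<in> \<F>"
          using SZ(1,2) SY(1,2) ZY(3,4) unfolding mem_intermediate by blast+
        have "Z <+>\<^bsub>R\<^esub> Q \<subseteq> Y <+>\<^bsub>R\<^esub> Q" using ZY(4) unfolding subset_iff mem_set_add by blast
        moreover have "Z <+>\<^bsub>R\<^esub> Q \<noteq> Y <+>\<^bsub>R\<^esub> Q" using trY trZ ZY(4) by auto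
        ultimately show "Z <+>\<^bsub>R\<^esub> Q \<subset> Y <+>\<^bsub>R\<^esub> Q" by blast
        fix A assume A: "A \<in> \<F>" "Z <+>\<^bsub>R\<^esub> Q \<subseteq> A" "A \<subseteq> Y <+>\<^bsub>R\<^esub> Q"
        then have sA: "subring A R" unfolding mem_intermediate by blast
        have "A \<inter> V = Z \<or> A \<inter> V = Y"
          using ZY(5)[OF subring_inter[OF sA VW(1)]] A(2,3) trY trZ by blast
        moreover have "A \<subseteq> (A \<inter> V) <+>\<^bsub>R\<^esub> Q" using split[OF sA] SZ(3) A(2,3) SY(4) by blast
        moreover have "(A \<inter> V) <+>\<^bsub>R\<^esub> Q \<subseteq> A"
          using subringE(7)[OF sA] SZ(3) A(2) unfolding subset_iff mem_set_add by blast
        ultimately show "A = Z <+>\<^bsub>R\<^esub> Q \<or> A = Y <+>\<^bsub>R\<^esub> Q" by auto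
      qed
      then show ?thesis using IH rk_cover[OF Z(2)] rk_cover by fastforce
    qed simp
  qed
  have "W \<inter> V = V" using VW(4) by blast
  then have "V <+>\<^bsub>R\<^esub> Q = W" using split[OF VW(2) Q'(1)] sum(4)[OF VW(1)] by auto
  then show ?thesis using shift[OF covered_mem(1)[OF cov] T(3)] by simp
qed

text \<open>Modulo the conductor, \<open>Q\<close> becomes a minimal nonzero ideal of
  \<open>W\<close>. Such an ideal contains a nonzero element of square zero or a nonzero idempotent;
  \<open>e = \<zero>\<close> and \<open>e = \<one>\<close> encode these two cases in one
  equation.\<close>

lemma nilpotent_or_idempotent:
  assumes cov: "covered_in \<F> V W" and Q: "rel_ideal W Q" "Q \<inter> V = conductor V W"
    and compl: "\<And>w. w \<in> W \<Longrightarrow> \<exists>v\<in>V. w \<ominus> v \<in> Q"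
  obtains q e where "q \<in> Q" "q \<notin> V" "e \<in> {\<zero>, \<one>}" "q \<otimes> q \<ominus> e \<otimes> q \<in> conductor V W"
proof -
  note VW = covered_subringD[OF cov]
  note V' = subringE[OF VW(1)] and W' = subringE[OF VW(2)] and Q' = rel_idealD[OF VW(2) Q(1)]
  note M = rel_ideal_conductor[OF VW(1,2)]
  note M' = rel_idealD[OF VW(2) M]
  let ?M = "conductor V W"
  have car: "\<And>x. x \<in> W \<Longrightarrow> x \<in> carrier R" using W'(1) by blast
  have QW: "\<And>x. x \<in> Q \<Longrightarrow> x \<in> W" using Q'(1) by blast
  \<comment> \<open>An ideal \<open>J\<close> not inside \<open>V\<close> satisfies
    \<open>V + J = W\<close>. Writing an element of \<open>Q\<close> as \<open>v + j\<close> leaves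
    \<open>v\<close> in \<open>Q \<inter> V\<close>, which is the conductor and is contained in
    \<open>J\<close>.\<close>
  have simple: "Q \<subseteq> J" if J: "rel_ideal W J" "?M \<subseteq> J" "J \<subseteq> Q" and x: "x \<in> J" "x \<notin> V" for J x
  proof -
    note S = subring_add_rel_ideal[OF VW(1,2) psubset_imp_subset[OF VW(4)] J(1)]
    have VJ: "V <+>\<^bsub>R\<^esub> J = W" using VW(5)[OF S(1,2,4)] S(3) x by blast
    note J' = rel_idealD[OF VW(2) J(1)]
    show "Q \<subseteq> J"
    proof
      fix y assume y: "y \<in> Q"
      then have "y \<in> V <+>\<^bsub>R\<^esub> J" using VJ QW by blast
      from iffD1[OF mem_set_add this] obtain v j where vj: "v \<in> V" "j \<in> J" "y = v \<oplus> j" by blast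
      have "v \<in> carrier R" "j \<in> carrier R" using vj(1,2) V'(1) J'(2) by blast+
      then have "v = y \<ominus> j" unfolding vj by algebra
      then have "v \<in> Q" using Q'(8)[OF y] vj(2) J(3) by blast
      then have "v \<in> J" using vj(1) Q(2) J(2) by blast
      then show "y \<in> J" using vj J'(4) by blast
    qed
  qed
  obtain q where q: "q \<in> Q" "q \<notin> V"
  proof -
    obtain w where w: "w \<in> W" "w \<notin> V" using VW(4) by blast
    obtain v where v: "v \<in> V" "w \<ominus> v \<in> Q" using compl[OF w(1)] by blast
    have "w = v \<oplus> (w \<ominus> v)" using subsetD[OF V'(1) v(1)] car[OF w(1)] by algebra
    then have "w \<ominus> v \<notin> V" using V'(7)[OF v(1), of "w \<ominus> v"] w(2) by auto
    then show thesis using that v(2) by blast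
  qed
  show thesis
  proof (cases "q \<otimes> q \<in> V")
    case True
    then have "q \<otimes> q \<in> ?M" using Q(2) Q'(5)[OF QW[OF q(1)] q(1)] by blast
    moreover have "q \<otimes> q \<ominus> \<zero> \<otimes> q = q \<otimes> q" using car[OF QW[OF q(1)]] by algebra
    ultimately show thesis using that[OF q, of \<zero>] by simp
  next
    case False
    have qW: "q \<in> W" and qqQ: "q \<otimes> q \<in> Q" using QW[OF q(1)] Q'(5) q(1) by blast+
    note qqW = QW[OF qqQ] and MQ = Q(2)[symmetric]
    let ?J = "?M <+>\<^bsub>R\<^esub> ((\<otimes>) (q \<otimes> q) ` W)"
    note J = rel_ideal_add_principal[OF VW(2) M qqW]
    have "?J \<subseteq> Q"
      using Q'(4,6) qqQ MQ unfolding subset_iff mem_set_add by blast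
    then have "Q \<subseteq> ?J" using simple[OF J(1,2) _ J(3) False] by blast
    then have "q \<in> ?J" using q(1) by blast
    from iffD1[OF mem_set_add this] obtain m s where ms: "m \<in> ?M" "s \<in> W" "q = m \<oplus> (q \<otimes> q) \<otimes> s" by blast
    \<comment> \<open>By minimality \<open>q^2\<close> generates \<open>Q\<close> modulo the
      conductor, so \<open>q\<close> is congruent to \<open>q^2 s\<close>, and
      \<open>e = q s\<close> acts as an identity on \<open>q\<close>.\<close>
    define e where "e = q \<otimes> s"
    have eQ: "e \<in> Q" unfolding e_def using Q'(6)[OF q(1) ms(2)] .
    note eW = QW[OF eQ]
    have c: "q \<in> carrier R" "m \<in> carrier R" "s \<in> carrier R" "e \<in> carrier R"
      using car qW ms(2) eW M'(2) ms(1) by blast+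
    have "q \<ominus> q \<otimes> e = (m \<oplus> (q \<otimes> q) \<otimes> s) \<ominus> q \<otimes> (q \<otimes> s)" unfolding e_def using ms(3) by simp
    also have "\<dots> = m" using c by algebra
    finally have qe: "q \<ominus> q \<otimes> e \<in> ?M" using ms(1) by simp
    \<comment> \<open>The annihilator of \<open>q\<close> in \<open>Q\<close> modulo the conductor.
      It omits \<open>q\<close> because \<open>q^2\<close> is not in \<open>V\<close>, so by
      minimality it reduces to the conductor; it contains \<open>e^2 - e\<close>, which makes
      \<open>e\<close> idempotent.\<close>
    define A where "A = {y \<in> Q. q \<otimes> y \<in> ?M}"
    have A: "rel_ideal W A"
      unfolding rel_ideal_def
    proof (intro conjI ballI)
      show "A \<subseteq> W" using QW unfolding A_def by blast
      show "\<zero> \<in> A" using Q'(3) M'(3) c(1) unfolding A_def by simp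
      show "x \<oplus> y \<in> A" if "x \<in> A" "y \<in> A" for x y
        using that Q'(4) M'(4) c(1) car QW unfolding A_def by (simp add: r_distr)
      fix x y assume x: "x \<in> W" and y: "y \<in> A"
      then have y': "y \<in> Q" "q \<otimes> y \<in> ?M" unfolding A_def by auto
      have "q \<otimes> (x \<otimes> y) = x \<otimes> (q \<otimes> y)" using c(1) car[OF x] car[OF QW[OF y'(1)]] by algebra
      then show "x \<otimes> y \<in> A" using Q'(5)[OF x y'(1)] M'(5)[OF x y'(2)] unfolding A_def by simp
    qed
    have "?M \<subseteq> A" using MQ M'(5)[OF qW] unfolding A_def by blast
    moreover have "A \<subseteq> Q" unfolding A_def by blast
    moreover have "q \<notin> A" using False conductor_subset[OF VW(2)] unfolding A_def by blast
    ultimately have AV: "A \<subseteq> V" using simple[OF A] q(1) by blast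
    have "q \<otimes> (e \<otimes> e \<ominus> e) = \<ominus> (e \<otimes> (q \<ominus> q \<otimes> e))" using c by algebra
    then have "q \<otimes> (e \<otimes> e \<ominus> e) \<in> ?M" using M'(7)[OF M'(5)[OF eW qe]] by simp
    moreover have eeQ: "e \<otimes> e \<ominus> e \<in> Q" using Q'(8)[OF Q'(5)[OF eW eQ] eQ] .
    ultimately have "e \<otimes> e \<ominus> e \<in> V" using AV unfolding A_def by blast
    then have "e \<otimes> e \<ominus> \<one> \<otimes> e \<in> ?M" using eeQ MQ c(4) by auto
    moreover have "e \<notin> V"
    proof
      assume "e \<in> V"
      then have "e \<in> ?M" using eQ MQ by blast
      moreover have "q = (q \<ominus> q \<otimes> e) \<oplus> q \<otimes> e" using c by algebra
      ultimately have "q \<in> ?M" using M'(4)[OF qe M'(5)[OF qW]] by fastforce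
      then show False using q(2) conductor_subset[OF VW(2)] by blast
    qed
    ultimately show thesis using that[OF eQ, of \<one>] by blast
  qed
qed

text \<open>The rank shift gives \<open>T + Q\<close> exactly one more than the rank of
  \<open>T\<close>, which leaves no room for the ring \<open>Y = T + T q\<close> strictly between
  them.\<close>

lemma conductor_not_in_smaller:
  assumes cov: "covered_in \<F> V W" and onto: "residually_onto V W"
    and T: "T \<in> \<F>" "T \<subset> V"
  shows "\<not> conductor V W \<subseteq> T"
proof
  let ?M = "conductor V W"
  assume MT: "?M \<subseteq> T"
  note VW = covered_subringD[OF cov]
  note V' = subringE[OF VW(1)] and W' = subringE[OF VW(2)]
  have sT: "subring T R" "B \<subseteq> T" using T(1) unfolding mem_intermediate by auto
  note T' = subringE[OF sT(1)]
  obtain Q where Qp: "rel_prime W Q" and QV: "Q \<inter> V = ?M"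
    and compl: "\<And>w. w \<in> W \<Longrightarrow> \<exists>v\<in>V. w \<ominus> v \<in> Q"
    using cov onto by (rule prime_complement) blast
  note Q = rel_primeD(1)[OF Qp]
  note Q' = rel_idealD[OF VW(2) Q]
  obtain q e where q: "q \<in> Q" "q \<notin> V" and e: "e \<in> {\<zero>, \<one>}" and qe: "q \<otimes> q \<ominus> e \<otimes> q \<in> ?M"
    using cov Q QV compl by (rule nilpotent_or_idempotent)
  have TV: "T \<subseteq> V" and TW: "T \<subseteq> W" using T(2) VW(4) by blast+
  have car: "\<And>x. x \<in> W \<Longrightarrow> x \<in> carrier R" using W'(1) by blast
  have qW: "q \<in> W" using q(1) Q'(1) by blast
  have eT: "e \<in> T" using e T'(2,3) by blast
  define Y where "Y = {t \<oplus> s \<otimes> q | t s. t \<in> T \<and> s \<in> T}"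
  have YI: "t \<oplus> s \<otimes> q \<in> Y" if "t \<in> T" "s \<in> T" for t s using that unfolding Y_def by blast
  have TY: "T \<subseteq> Y"
  proof
    fix t assume t: "t \<in> T"
    have "t \<oplus> \<zero> \<otimes> q = t" using car[OF qW] car[OF subsetD[OF TW t]] by simp
    then show "t \<in> Y" using YI[OF t T'(2)] by simp
  qed
  have "\<zero> \<oplus> \<one> \<otimes> q = q" using car[OF qW] by simp
  then have qY: "q \<in> Y" using YI[OF T'(2,3)] by simp
  have YW: "Y \<subseteq> W" using TW qW W'(6,7) unfolding Y_def by blast
  have Ysub: "subring Y R"
  proof (rule subringI)
    show "Y \<subseteq> carrier R" using YW W'(1) by blast
    show "\<one> \<in> Y" using TY T'(3) by blast
    show "\<ominus> h \<in> Y" if h: "h \<in> Y" for h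
    proof -
      obtain t s where ts: "t \<in> T" "s \<in> T" "h = t \<oplus> s \<otimes> q" using h unfolding Y_def by blast
      have "t \<in> carrier R" "s \<in> carrier R" "q \<in> carrier R" using ts car TW qW by blast+
      then have "\<ominus> h = \<ominus> t \<oplus> (\<ominus> s) \<otimes> q" unfolding ts by algebra
      then show ?thesis using YI[OF T'(5)[OF ts(1)] T'(5)[OF ts(2)]] by simp
    qed
    fix g h assume "g \<in> Y" "h \<in> Y"
    then obtain t s t' s' where ts: "t \<in> T" "s \<in> T" "g = t \<oplus> s \<otimes> q"
      "t' \<in> T" "s' \<in> T" "h = t' \<oplus> s' \<otimes> q" unfolding Y_def by blast
    \<comment> \<open>A product of two elements of \<open>Y\<close> involves
      \<open>q^2 = m + e q\<close>. Here \<open>m\<close> is in the conductor, which is assumed to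
      lie in \<open>T\<close>, and \<open>e\<close> is in \<open>T\<close>, so no power of
      \<open>q\<close> beyond the first survives.\<close>
    define m where "m = q \<otimes> q \<ominus> e \<otimes> q"
    have mT: "m \<in> T" using qe MT unfolding m_def by blast
    have c: "t \<in> carrier R" "s \<in> carrier R" "t' \<in> carrier R" "s' \<in> carrier R" "q \<in> carrier R"
      "e \<in> carrier R" "m \<in> carrier R" using ts(1,2,4,5) eT mT car TW qW by blast+
    have "g \<oplus> h = (t \<oplus> t') \<oplus> (s \<oplus> s') \<otimes> q" unfolding ts using c by algebra
    then show "g \<oplus> h \<in> Y" using YI[OF T'(7)[OF ts(1,4)] T'(7)[OF ts(2,5)]] by simp
    have "g \<otimes> h = (t \<otimes> t' \<oplus> (s \<otimes> s') \<otimes> m) \<oplus> (t \<otimes> s' \<oplus> s \<otimes> t' \<oplus> (s \<otimes> s') \<otimes> e) \<otimes> q"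
      unfolding ts m_def using c by algebra
    moreover have "t \<otimes> t' \<oplus> (s \<otimes> s') \<otimes> m \<in> T" "t \<otimes> s' \<oplus> s \<otimes> t' \<oplus> (s \<otimes> s') \<otimes> e \<in> T"
      using ts(1,2,4,5) mT eT by (auto intro!: T'(6,7))
    ultimately show "g \<otimes> h \<in> Y" using YI by simp
  qed
  note S = subring_add_rel_ideal[OF sT(1) VW(2) TW Q]
  have "Y \<subseteq> T <+>\<^bsub>R\<^esub> Q"
    using Q'(5)[OF _ q(1)] TW unfolding Y_def mem_set_add subset_iff by blast
  moreover have "\<not> T <+>\<^bsub>R\<^esub> Q \<subseteq> Y"
  proof
    \<comment> \<open>For \<open>v\<close> in \<open>V - T\<close> the element \<open>v q\<close> of
      \<open>Q\<close> would be \<open>t + s q\<close>, so that \<open>(v - s) q = t\<close> lies in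
      \<open>Q \<inter> V\<close>, the conductor. Since \<open>v - s\<close> is outside the
      conductor, cancellation would put \<open>q\<close> into it.\<close>
    assume le: "T <+>\<^bsub>R\<^esub> Q \<subseteq> Y"
    obtain v where v: "v \<in> V" "v \<notin> T" using T(2) by blast
    have vW: "v \<in> W" using v(1) VW(4) by blast
    have "v \<otimes> q \<in> Y" using Q'(5)[OF vW q(1)] S(3) le by blast
    then obtain t s where ts: "t \<in> T" "s \<in> T" "v \<otimes> q = t \<oplus> s \<otimes> q" unfolding Y_def by blast
    have c: "v \<in> carrier R" "t \<in> carrier R" "s \<in> carrier R" "q \<in> carrier R"
      using ts(1,2) TW vW qW car by blast+
    have "(v \<ominus> s) \<otimes> q = v \<otimes> q \<ominus> s \<otimes> q" using c by algebra
    also have "\<dots> = t" unfolding ts(3) using c by algebra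
    finally have t: "(v \<ominus> s) \<otimes> q = t" .
    have vs: "v \<ominus> s \<in> V" using subring_minus[OF VW(1) v(1)] ts(2) TV by blast
    then have "t \<in> Q" using Q'(5)[OF _ q(1)] t VW(4) by blast
    then have "(v \<ominus> s) \<otimes> q \<in> ?M" using QV ts(1) TV t by blast
    moreover have "v \<ominus> s \<notin> ?M"
    proof
      assume "v \<ominus> s \<in> ?M"
      then have "(v \<ominus> s) \<oplus> s \<in> T" using MT T'(7) ts(2) by blast
      moreover have "(v \<ominus> s) \<oplus> s = v" using c by algebra
      ultimately show False using v(2) by simp
    qed
    ultimately have "q \<in> ?M" using cancel_mod_conductor[OF cov vs _ qW] by blast
    then show False using q(2) conductor_subset[OF VW(2)] by blast
  qed
  ultimately have "Y \<subset> T <+>\<^bsub>R\<^esub> Q" by blast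
  moreover have "T \<subset> Y" using TY qY q(2) TV by blast
  moreover have "Y \<in> \<F>" "T <+>\<^bsub>R\<^esub> Q \<in> \<F>"
    using Ysub S(1,2) TY sT(2) unfolding mem_intermediate by blast+
  ultimately have "rk T < rk Y" "rk Y < rk (T <+>\<^bsub>R\<^esub> Q)" using rk_mono T(1) by blast+
  moreover have "rk V + rk (T <+>\<^bsub>R\<^esub> Q) = rk W + rk T"
    using cov Q QV compl T(1) MT TV by (rule rank_shift)
  ultimately show False using rk_cover[OF cov] by simp
qed

text \<open>Maximality of \<open>V2\<close> gives \<open>V2 + J = W\<close>, so \<open>t\<close> and
  \<open>v\<close> taken from \<open>V1\<close> can be moved into \<open>V2\<close> by subtracting
  elements of \<open>J\<close>. This changes nothing modulo \<open>Q \<supseteq> J\<close> and does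
  not leave \<open>V1 \<supseteq> J\<close>. The ideal is left general so that either conductor can
  play its part.\<close>

lemma residually_onto_Int_at_conductor:
  assumes W: "subring W R" and V1: "subring V1 R" "V1 \<subseteq> W" and cov: "covered_in \<F> V2 W"
    and onto: "residually_onto V1 W"
    and J: "rel_ideal W J" "J \<subseteq> V1" "\<not> J \<subseteq> V2"
    and Q: "rel_prime W Q" "J \<subseteq> Q" and x: "x \<in> W"
  shows "\<exists>t\<in>V1 \<inter> V2. \<exists>v\<in>V1 \<inter> V2. t \<notin> Q \<and> t \<otimes> x \<ominus> v \<in> Q"
proof -
  note VW = covered_subringD[OF cov]
  note V1' = subringE[OF V1(1)] and V2' = subringE[OF VW(1)] and W' = subringE[OF W]
  note Q' = rel_idealD[OF W rel_primeD(1)[OF Q(1)]] and J' = rel_idealD[OF W J(1)]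
  note S = subring_add_rel_ideal[OF VW(1,2) psubset_imp_subset[OF VW(4)] J(1)]
  have sum: "V2 <+>\<^bsub>R\<^esub> J = W" using VW(5)[OF S(1,2,4)] S(3) J(3) by blast
  obtain t v where t: "t \<in> V1" "v \<in> V1" "t \<notin> Q" "t \<otimes> x \<ominus> v \<in> Q"
    using onto Q(1) x by (rule residually_ontoD)
  have repr: "\<exists>u'\<in>V1 \<inter> V2. u \<ominus> u' \<in> Q" if u: "u \<in> V1" "u \<in> W" for u
  proof -
    have "u \<in> V2 <+>\<^bsub>R\<^esub> J" using u sum by blast
    from iffD1[OF mem_set_add this] obtain u' j where uj: "u' \<in> V2" "j \<in> J" "u = u' \<oplus> j" by blast
    have c: "u' \<in> carrier R" "j \<in> carrier R" using uj(1,2) V2'(1) J'(2) by blast+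
    have "u' = u \<ominus> j" "u \<ominus> u' = j" unfolding uj using c by algebra+
    then show ?thesis using subring_minus[OF V1(1) u(1)] uj(1,2) J(2) Q(2) by (metis IntI subsetD)
  qed
  obtain t' where t': "t' \<in> V1 \<inter> V2" "t \<ominus> t' \<in> Q" using repr t(1) V1(2) by blast
  obtain v' where v': "v' \<in> V1 \<inter> V2" "v \<ominus> v' \<in> Q" using repr t(2) V1(2) by blast
  have c: "t \<in> carrier R" "v \<in> carrier R" "t' \<in> carrier R" "v' \<in> carrier R" "x \<in> carrier R"
    using t(1,2) t'(1) v'(1) x V1'(1) W'(1) by blast+
  have "t = (t \<ominus> t') \<oplus> t'" using c by algebra
  then have "t' \<notin> Q" using Q'(4)[OF t'(2), of t'] t(3) by auto
  moreover have "t' \<otimes> x \<ominus> v' = ((t \<otimes> x \<ominus> v) \<ominus> (t \<ominus> t') \<otimes> x) \<oplus> (v \<ominus> v')" using c by algebra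
  then have "t' \<otimes> x \<ominus> v' \<in> Q" using Q'(4)[OF Q'(8)[OF t(4) Q'(6)[OF t'(2) x]] v'(2)] by simp
  ultimately show ?thesis using t'(1) v'(1) by blast
qed

lemma residually_onto_Int_of_covers:
  assumes cov1: "covered_in \<F> V1 W" and cov2: "covered_in \<F> V2 W" and ne: "V1 \<noteq> V2"
    and onto1: "residually_onto V1 W" and onto2: "residually_onto V2 W"
  shows "residually_onto (V1 \<inter> V2) W"
  unfolding residually_onto_def
proof (intro allI impI)
  fix Q x assume Q: "rel_prime W Q" and x: "x \<in> W"
  let ?M = "conductor V1 W" and ?N = "conductor V2 W"
  note VW1 = covered_subringD[OF cov1] and VW2 = covered_subringD[OF cov2]
  note W' = subringE[OF VW1(2)]
  have M: "rel_ideal W ?M" and N: "rel_ideal W ?N"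
    using rel_ideal_conductor VW1(1,2) VW2(1) by blast+
  note M' = rel_idealD[OF VW1(2) M] and N' = rel_idealD[OF VW1(2) N]
  have MV: "?M \<subseteq> V1" and NV: "?N \<subseteq> V2" using conductor_subset VW1(2) by blast+
  have T: "V1 \<inter> V2 \<in> \<F>"
    using subring_inter[OF VW1(1) VW2(1)] VW1(3) VW2(3) unfolding mem_intermediate by blast
  \<comment> \<open>Distinct maximal subrings are incomparable, so the intersection is proper in
    each of them; hence neither conductor is contained in the other subring.\<close>
  have "\<not> V1 \<subseteq> V2" "\<not> V2 \<subseteq> V1" using VW1(4,5) VW2(4,5) VW1(1) VW2(1) ne by blast+
  then have "V1 \<inter> V2 \<subset> V1" "V1 \<inter> V2 \<subset> V2" by blast+
  then have "\<not> ?M \<subseteq> V1 \<inter> V2" "\<not> ?N \<subseteq> V1 \<inter> V2"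
    using conductor_not_in_smaller[OF cov1 onto1 T] conductor_not_in_smaller[OF cov2 onto2 T] by blast+
  then have MV2: "\<not> ?M \<subseteq> V2" and NV1: "\<not> ?N \<subseteq> V1" using MV NV by blast+
  consider "?M \<subseteq> Q" | "?N \<subseteq> Q" | "\<not> ?M \<subseteq> Q" "\<not> ?N \<subseteq> Q" by blast
  then show "\<exists>t\<in>V1 \<inter> V2. \<exists>v\<in>V1 \<inter> V2. t \<notin> Q \<and> t \<otimes> x \<ominus> v \<in> Q"
  proof cases
    case 1
    with VW1(2,1) psubset_imp_subset[OF VW1(4)] cov2 onto1 M MV MV2 Q show ?thesis
      using x by (rule residually_onto_Int_at_conductor)
  next
    case 2
    with VW1(2) VW2(1) psubset_imp_subset[OF VW2(4)] cov1 onto2 N NV NV1 Q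
    have "\<exists>t\<in>V2 \<inter> V1. \<exists>v\<in>V2 \<inter> V1. t \<notin> Q \<and> t \<otimes> x \<ominus> v \<in> Q"
      using x by (rule residually_onto_Int_at_conductor)
    then show ?thesis by (simp add: Int_commute)
  next
    case 3
    \<comment> \<open>The product \<open>m n\<close> lies in both conductors and outside
      \<open>Q\<close>. As denominator it gives \<open>m n x\<close> in both subrings, and the
      congruence becomes an equality.\<close>
    then obtain m n where m: "m \<in> ?M" "m \<notin> Q" and n: "n \<in> ?N" "n \<notin> Q" by blast
    then have mnW: "m \<in> W" "n \<in> W" using M'(1) N'(1) by blast+
    then have "m \<otimes> n \<notin> Q" using rel_primeD(3)[OF Q] m(2) n(2) by blast
    moreover have mn: "m \<otimes> n \<in> ?M \<inter> ?N" using M'(6)[OF m(1) mnW(2)] N'(5)[OF mnW(1) n(1)] by blast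
    moreover have "m \<otimes> n \<otimes> x \<in> V1 \<inter> V2" using mn x unfolding conductor_def by blast
    moreover have "m \<otimes> n \<otimes> x \<ominus> m \<otimes> n \<otimes> x \<in> Q"
      using rel_idealD(3)[OF VW1(2) rel_primeD(1)[OF Q]] mnW x W'(1)
      by (simp add: a_minus_def r_neg subset_iff)
    ultimately show ?thesis using MV NV by blast
  qed
qed

text \<open>Newman-style confluence: distinct maximal subrings containing \<open>V1\<close> and \<open>V2\<close> are compared first, and the
  induction hypothesis is applied inside each of them.\<close>

lemma residually_onto_Int:
  assumes "W \<in> \<F>" "V1 \<in> \<F>" "V2 \<in> \<F>" "V1 \<subseteq> W" "V2 \<subseteq> W"
    and "residually_onto V1 W" "residually_onto V2 W"
  shows "residually_onto (V1 \<inter> V2) W"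
  using assms
proof (induct "rk W" arbitrary: W V1 V2 rule: less_induct)
  case less
  show ?case
  proof (cases "V1 = W \<or> V2 = W")
    case True
    then show ?thesis using less(5-8) by (auto simp: Int_absorb1 Int_absorb2)
  next
    case False
    then have "V1 \<subset> W" "V2 \<subset> W" using less by blast+
    obtain W1 where W1: "V1 \<subseteq> W1" "covered_in \<F> W1 W"
      using finite_chains less(3,2) \<open>V1 \<subset> W\<close> by (rule finite_chains_exists_cover)
    obtain W2 where W2: "V2 \<subseteq> W2" "covered_in \<F> W2 W"
      using finite_chains less(4,2) \<open>V2 \<subset> W\<close> by (rule finite_chains_exists_cover)
    note VW1 = covered_subringD[OF W1(2)] and VW2 = covered_subringD[OF W2(2)]
    note mem = covered_mem(1)[OF W1(2)] covered_mem(1)[OF W2(2)]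
    have mem_Int: "Y \<inter> Z \<in> \<F>" if "Y \<in> \<F>" "Z \<in> \<F>" for Y Z
      using that subring_inter unfolding mem_intermediate by blast
    note sub = iffD1[OF mem_intermediate, THEN conjunct1]
    \<comment> \<open>The induction hypothesis speaks only of rings of smaller rank:
      \<open>into\<close> passes from \<open>W\<close> to a maximal subring, and \<open>out\<close>
      returns to \<open>W\<close> by transitivity.\<close>
    have into: "residually_onto Y Z" if "Y \<in> \<F>" "covered_in \<F> Z W" "Y \<subseteq> Z" "residually_onto Y W" for Y Z
      using sub[OF that(1)] covered_subringD(1,2)[OF that(2)] that(3)
        psubset_imp_subset[OF covered_subringD(4)[OF that(2)]]
        intermediate_integral[OF covered_subringD(3,2)[OF that(2)]] that(4)
      by (rule residually_onto_restrict)
    have out: "residually_onto Y W"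
      if "Y \<in> \<F>" "covered_in \<F> Z W" "Y \<subseteq> Z" "residually_onto Y Z" "residually_onto Z W" for Y Z
      using sub[OF that(1)] covered_subringD(1,2)[OF that(2)] that(3)
        psubset_imp_subset[OF covered_subringD(4)[OF that(2)]] that(4,5)
      by (rule residually_onto_trans)
    have onto: "residually_onto W1 W" "residually_onto W2 W"
      using residually_onto_mono less(7,8) W1(1) W2(1) by blast+
    have Int: "residually_onto (W1 \<inter> W2) W"
    proof (cases "W1 = W2")
      case True
      then show ?thesis using onto(1) by simp
    next
      case False
      with W1(2) W2(2) show ?thesis using onto by (rule residually_onto_Int_of_covers)
    qed
    have rk: "rk W1 < rk W" "rk W2 < rk W" using rk_cover[OF W1(2)] rk_cover[OF W2(2)] by simp_all
    note WW = mem_Int[OF mem] and VW = mem_Int[OF less(3) mem(2)]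
    \<comment> \<open>Inside \<open>W1\<close> the pair is \<open>V1\<close> and
      \<open>W1 \<inter> W2\<close>, with intersection \<open>V1 \<inter> W2\<close>. This ring also
      lies in \<open>W2\<close>, where it is then paired with \<open>V2\<close>.\<close>
    have "residually_onto (V1 \<inter> (W1 \<inter> W2)) W1"
      using less(1)[OF rk(1) mem(1) less(3) WW W1(1) Int_lower1]
        into[OF less(3) W1(2,1) less(7)] into[OF WW W1(2) Int_lower1 Int] by blast
    moreover have "V1 \<inter> (W1 \<inter> W2) = V1 \<inter> W2" using W1(1) by blast
    ultimately have "residually_onto (V1 \<inter> W2) W1" by simp
    then have "residually_onto (V1 \<inter> W2) W" using out[OF VW W1(2)] W1(1) onto(1) by blast
    then have "residually_onto (V1 \<inter> W2) W2" using into[OF VW W2(2)] by blast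
    then have "residually_onto (V1 \<inter> W2 \<inter> V2) W2"
      using less(1)[OF rk(2) mem(2) VW less(4) Int_lower2 W2(1)] into[OF less(4) W2(2,1) less(8)] by blast
    moreover have "V1 \<inter> W2 \<inter> V2 = V1 \<inter> V2" using W2(1) by blast
    ultimately have "residually_onto (V1 \<inter> V2) W2" by simp
    then show ?thesis using out[OF mem_Int[OF less(3,4)] W2(2)] W2(1) onto(2) by blast
  qed
qed

lemma least_residually_onto:
  assumes B: "subring B R"
  shows "\<exists>V\<in>\<F>. residually_onto V (carrier R) \<and> (\<forall>W\<in>\<F>. residually_onto W (carrier R) \<longrightarrow> V \<subseteq> W)"
proof -
  let ?P = "\<lambda>V. V \<in> \<F> \<and> residually_onto V (carrier R)"
  have top: "carrier R \<in> \<F>"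
    using carrier_is_subring subringE(1)[OF B] unfolding mem_intermediate by blast
  then have "?P (carrier R)" using residually_onto_refl[OF carrier_is_subring] by blast
  then obtain V where V: "?P V" and min: "\<And>W. ?P W \<Longrightarrow> rk V \<le> rk W"
    using ex_has_least_nat[of ?P "carrier R" rk] by blast
  have car: "W \<subseteq> carrier R" if "W \<in> \<F>" for W using that subringE(1) unfolding mem_intermediate by blast
  \<comment> \<open>Otherwise \<open>V \<inter> W\<close> would be a smaller candidate, and its rank
    would be strictly below the minimum.\<close>
  have "V \<subseteq> W" if W: "W \<in> \<F>" "residually_onto W (carrier R)" for W
  proof (rule ccontr)
    assume "\<not> V \<subseteq> W"
    then have less: "V \<inter> W \<subset> V" by blast
    have mem: "V \<inter> W \<in> \<F>" using V W(1) subring_inter unfolding mem_intermediate by blast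
    moreover have "residually_onto (V \<inter> W) (carrier R)"
      using residually_onto_Int[OF top _ W(1) _ car[OF W(1)] _ W(2)] V car by blast
    ultimately show False using min[of "V \<inter> W"] rk_mono[OF mem _ less] V by fastforce
  qed
  then show ?thesis using V by blast
qed

end

section \<open>Residue fields\<close>

context cring
begin

abbreviation sub_fraction :: "'a set \<Rightarrow> 'a set \<Rightarrow> 'a \<Rightarrow> 'a \<Rightarrow> ('a \<times> 'a) set" where
  "sub_fraction U P \<equiv> fraction (R\<lparr>carrier := U\<rparr>) (U - P)"

text \<open>The coset of \<open>a/s\<close> in the residue field, described by cross-multiplication:
  all fractions \<open>b/t\<close> congruent to \<open>a/s\<close> modulo the maximal ideal of the
  local ring.\<close>

definition residue_class :: "'a set \<Rightarrow> 'a set \<Rightarrow> 'a \<Rightarrow> 'a \<Rightarrow> ('a \<times> 'a) set set" where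
  "residue_class U P a s =
     {sub_fraction U P b t | b t. b \<in> U \<and> t \<in> U - P \<and> t \<otimes> a \<ominus> s \<otimes> b \<in> P}"

section \<open>Fractions and residue classes at a prime of a subring\<close>

context
  fixes U P
  assumes U: "subring U R" and P: "rel_prime U P"
begin

private lemma UE: "U \<subseteq> carrier R" "\<zero> \<in> U" "\<one> \<in> U" "U \<noteq> {}"
  "\<And>h. h \<in> U \<Longrightarrow> \<ominus> h \<in> U" "\<And>h k. h \<in> U \<Longrightarrow> k \<in> U \<Longrightarrow> h \<otimes> k \<in> U"
  "\<And>h k. h \<in> U \<Longrightarrow> k \<in> U \<Longrightarrow> h \<oplus> k \<in> U"
  using subringE[OF U] by auto

private lemmas PE = rel_idealD[OF U rel_primeD(1)[OF P]]

private lemma Uc: "x \<in> U \<Longrightarrow> x \<in> carrier R"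
  using UE(1) by blast

private lemma denom_one: "\<one> \<in> U - P"
  using UE(3) rel_primeD(2)[OF P] by blast

private lemma denom_mult: "s \<in> U - P \<Longrightarrow> t \<in> U - P \<Longrightarrow> s \<otimes> t \<in> U - P"
  using UE(6) rel_primeD(3)[OF P] by blast

private lemma frac_rel_iff:
  "((a, s), (b, t)) \<in> frac_rel (R\<lparr>carrier := U\<rparr>) (U - P) \<longleftrightarrow>
     a \<in> U \<and> s \<in> U - P \<and> b \<in> U \<and> t \<in> U - P \<and> (\<exists>u\<in>U - P. u \<otimes> (t \<otimes> a) = u \<otimes> (s \<otimes> b))"
  unfolding frac_rel_def by auto

lemma equiv_frac_rel: "equiv (U \<times> (U - P)) (frac_rel (R\<lparr>carrier := U\<rparr>) (U - P))"
proof (rule equivI)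
  let ?r = "frac_rel (R\<lparr>carrier := U\<rparr>) (U - P)"
  show "?r \<subseteq> (U \<times> (U - P)) \<times> (U \<times> (U - P))" by (auto simp: frac_rel_iff)
  show "refl_on (U \<times> (U - P)) ?r"
    using denom_one unfolding refl_on_def by (auto simp: frac_rel_iff)
  show "sym ?r"
  proof (rule symI)
    fix x y assume "(x, y) \<in> ?r"
    then show "(y, x) \<in> ?r" by (cases x; cases y) (auto simp: frac_rel_iff eq_commute)
  qed
  show "trans ?r"
  proof (rule transI)
    fix x y z assume 1: "(x, y) \<in> ?r" and 2: "(y, z) \<in> ?r"
    obtain a s b t c r where xyz: "x = (a, s)" "y = (b, t)" "z = (c, r)" by (metis surj_pair)
    obtain u where u: "u \<in> U - P" "u \<otimes> (t \<otimes> a) = u \<otimes> (s \<otimes> b)" using 1 unfolding xyz frac_rel_iff by blast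
    obtain w where w: "w \<in> U - P" "w \<otimes> (r \<otimes> b) = w \<otimes> (t \<otimes> c)" using 2 unfolding xyz frac_rel_iff by blast
    have mem: "a \<in> U" "s \<in> U - P" "b \<in> U" "t \<in> U - P" "c \<in> U" "r \<in> U - P"
      using 1 2 unfolding xyz frac_rel_iff by blast+
    then have c: "a \<in> carrier R" "s \<in> carrier R" "b \<in> carrier R" "t \<in> carrier R" "c \<in> carrier R"
      "r \<in> carrier R" "u \<in> carrier R" "w \<in> carrier R" using u(1) w(1) Uc by blast+
    \<comment> \<open>The middle denominator \<open>t\<close> joins the two multipliers: eliminating
      \<open>b\<close> from the two relations leaves a factor \<open>t\<close> on both
      sides.\<close>
    have "(u \<otimes> w \<otimes> t) \<otimes> (r \<otimes> a) = w \<otimes> r \<otimes> (u \<otimes> (t \<otimes> a))" using c by algebra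
    also have "\<dots> = u \<otimes> s \<otimes> (w \<otimes> (r \<otimes> b))" unfolding u(2) using c by algebra
    also have "\<dots> = (u \<otimes> w \<otimes> t) \<otimes> (s \<otimes> c)" unfolding w(2) using c by algebra
    finally show "(x, z) \<in> ?r"
      unfolding xyz frac_rel_iff using mem denom_mult[OF denom_mult[OF u(1) w(1)] mem(4)] by blast
  qed
qed

lemma mem_fraction:
  "(b, t) \<in> sub_fraction U P a s \<longleftrightarrow>
     a \<in> U \<and> s \<in> U - P \<and> b \<in> U \<and> t \<in> U - P \<and> (\<exists>u\<in>U - P. u \<otimes> (t \<otimes> a) = u \<otimes> (s \<otimes> b))"
  unfolding fraction_def by (simp add: frac_rel_iff)

lemma fraction_eqI:
  assumes "a \<in> U" "s \<in> U - P" "b \<in> U" "t \<in> U - P" "u \<in> U - P" "u \<otimes> (t \<otimes> a) = u \<otimes> (s \<otimes> b)"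
  shows "sub_fraction U P a s = sub_fraction U P b t"
  unfolding fraction_def using assms
  by (intro equiv_class_eq[OF equiv_frac_rel]) (auto simp: frac_rel_iff)

lemma fraction_self: "a \<in> U \<Longrightarrow> s \<in> U - P \<Longrightarrow> (a, s) \<in> sub_fraction U P a s"
  using denom_one unfolding mem_fraction by blast

text \<open>Evaluates the unions over representatives by which sums and products of fractions are
  defined, once independence of representatives is known.\<close>

lemma fraction_UN2:
  assumes "a \<in> U" "s \<in> U - P" "b \<in> U" "t \<in> U - P"
    and const: "\<And>a' s' b' t'. (a', s') \<in> sub_fraction U P a s \<Longrightarrow> (b', t') \<in> sub_fraction U P b t \<Longrightarrow> f a' s' b' t' = K"
  shows "(\<Union>(a', s')\<in>sub_fraction U P a s. \<Union>(b', t')\<in>sub_fraction U P b t. f a' s' b' t') = K"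
  using fraction_self[OF assms(1,2)] fraction_self[OF assms(3,4)] const by fast

abbreviation "loc \<equiv> local_ring_at (R\<lparr>carrier := U\<rparr>) P"

lemma local_add:
  assumes ab: "a \<in> U" "s \<in> U - P" "b \<in> U" "t \<in> U - P"
  shows "sub_fraction U P a s \<oplus>\<^bsub>loc\<^esub> sub_fraction U P b t = sub_fraction U P (t \<otimes> a \<oplus> s \<otimes> b) (s \<otimes> t)"
proof -
  have "sub_fraction U P a s \<oplus>\<^bsub>loc\<^esub> sub_fraction U P b t = (\<Union>(a', s')\<in>sub_fraction U P a s.
      \<Union>(b', t')\<in>sub_fraction U P b t. sub_fraction U P (t' \<otimes> a' \<oplus> s' \<otimes> b') (s' \<otimes> t'))"
    unfolding local_ring_at_def localization_def by simp
  also have "\<dots> = sub_fraction U P (t \<otimes> a \<oplus> s \<otimes> b) (s \<otimes> t)"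
  proof (rule fraction_UN2[OF ab])
  fix a' s' b' t'
  assume *: "(a', s') \<in> sub_fraction U P a s" "(b', t') \<in> sub_fraction U P b t"
  obtain u where u: "u \<in> U - P" "u \<otimes> (s' \<otimes> a) = u \<otimes> (s \<otimes> a')" using * unfolding mem_fraction by blast
  obtain w where w: "w \<in> U - P" "w \<otimes> (t' \<otimes> b) = w \<otimes> (t \<otimes> b')" using * unfolding mem_fraction by blast
  have ab': "a' \<in> U" "s' \<in> U - P" "b' \<in> U" "t' \<in> U - P" using * unfolding mem_fraction by blast+
  have c: "a \<in> carrier R" "s \<in> carrier R" "b \<in> carrier R" "t \<in> carrier R" "a' \<in> carrier R"
    "s' \<in> carrier R" "b' \<in> carrier R" "t' \<in> carrier R" "u \<in> carrier R" "w \<in> carrier R"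
    using ab ab' u(1) w(1) Uc by blast+
  have "u \<otimes> w \<otimes> (s \<otimes> t \<otimes> (t' \<otimes> a' \<oplus> s' \<otimes> b'))
      = w \<otimes> t' \<otimes> t \<otimes> (u \<otimes> (s \<otimes> a')) \<oplus> u \<otimes> s' \<otimes> s \<otimes> (w \<otimes> (t \<otimes> b'))" using c by algebra
  also have "\<dots> = u \<otimes> w \<otimes> (s' \<otimes> t' \<otimes> (t \<otimes> a \<oplus> s \<otimes> b))"
    unfolding u(2)[symmetric] w(2)[symmetric] using c by algebra
    finally show "sub_fraction U P (t' \<otimes> a' \<oplus> s' \<otimes> b') (s' \<otimes> t') = sub_fraction U P (t \<otimes> a \<oplus> s \<otimes> b) (s \<otimes> t)"
      using ab ab' u(1) w(1) by (intro fraction_eqI[of _ _ _ _ "u \<otimes> w"] denom_mult UE(6,7)) simp_all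
  qed
  finally show ?thesis .
qed

lemma local_mult:
  assumes ab: "a \<in> U" "s \<in> U - P" "b \<in> U" "t \<in> U - P"
  shows "sub_fraction U P a s \<otimes>\<^bsub>loc\<^esub> sub_fraction U P b t = sub_fraction U P (a \<otimes> b) (s \<otimes> t)"
proof -
  have "sub_fraction U P a s \<otimes>\<^bsub>loc\<^esub> sub_fraction U P b t = (\<Union>(a', s')\<in>sub_fraction U P a s.
      \<Union>(b', t')\<in>sub_fraction U P b t. sub_fraction U P (a' \<otimes> b') (s' \<otimes> t'))"
    unfolding local_ring_at_def localization_def by simp
  also have "\<dots> = sub_fraction U P (a \<otimes> b) (s \<otimes> t)"
  proof (rule fraction_UN2[OF ab])
  fix a' s' b' t'
  assume *: "(a', s') \<in> sub_fraction U P a s" "(b', t') \<in> sub_fraction U P b t"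
  obtain u where u: "u \<in> U - P" "u \<otimes> (s' \<otimes> a) = u \<otimes> (s \<otimes> a')" using * unfolding mem_fraction by blast
  obtain w where w: "w \<in> U - P" "w \<otimes> (t' \<otimes> b) = w \<otimes> (t \<otimes> b')" using * unfolding mem_fraction by blast
  have ab': "a' \<in> U" "s' \<in> U - P" "b' \<in> U" "t' \<in> U - P" using * unfolding mem_fraction by blast+
  have c: "a \<in> carrier R" "s \<in> carrier R" "b \<in> carrier R" "t \<in> carrier R" "a' \<in> carrier R"
    "s' \<in> carrier R" "b' \<in> carrier R" "t' \<in> carrier R" "u \<in> carrier R" "w \<in> carrier R"
    using ab ab' u(1) w(1) Uc by blast+
  have "u \<otimes> w \<otimes> (s \<otimes> t \<otimes> (a' \<otimes> b')) = (u \<otimes> (s \<otimes> a')) \<otimes> (w \<otimes> (t \<otimes> b'))" using c by algebra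
  also have "\<dots> = u \<otimes> w \<otimes> (s' \<otimes> t' \<otimes> (a \<otimes> b))"
    unfolding u(2)[symmetric] w(2)[symmetric] using c by algebra
    finally show "sub_fraction U P (a' \<otimes> b') (s' \<otimes> t') = sub_fraction U P (a \<otimes> b) (s \<otimes> t)"
      using ab ab' u(1) w(1) by (intro fraction_eqI[of _ _ _ _ "u \<otimes> w"] denom_mult UE(6,7)) simp_all
  qed
  finally show ?thesis .
qed

lemma residue_classI:
  "b \<in> U \<Longrightarrow> t \<in> U - P \<Longrightarrow> t \<otimes> a \<ominus> s \<otimes> b \<in> P \<Longrightarrow> sub_fraction U P b t \<in> residue_class U P a s"
  unfolding residue_class_def by blast

lemma residue_classE:
  assumes "F \<in> residue_class U P a s"
  obtains b t where "b \<in> U" "t \<in> U - P" "t \<otimes> a \<ominus> s \<otimes> b \<in> P" "F = sub_fraction U P b t"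
  using assms unfolding residue_class_def by blast

text \<open>The coset consists of the sums of \<open>a/s\<close> with fractions whose numerator is
  in \<open>P\<close>. Clearing denominators turns this into the congruence in
  \<open>residue_class\<close>.\<close>

lemma coset_fraction:
  assumes a: "a \<in> U" "s \<in> U - P"
  shows "local_max_ideal (R\<lparr>carrier := U\<rparr>) P +>\<^bsub>loc\<^esub> sub_fraction U P a s = residue_class U P a s" (is "?L = ?C")
proof -
  have mem: "F \<in> ?L \<longleftrightarrow> (\<exists>p u. p \<in> P \<and> u \<in> U - P \<and> F = sub_fraction U P p u \<oplus>\<^bsub>loc\<^esub> sub_fraction U P a s)" for F
    unfolding a_r_coset_def' local_max_ideal_def by auto
  have sc: "a \<in> carrier R" "s \<in> carrier R" using a Uc by blast+
  show ?thesis
  proof (intro equalityI subsetI)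
    fix F assume "F \<in> ?L"
    then obtain p u where p: "p \<in> P" "u \<in> U - P" "F = sub_fraction U P p u \<oplus>\<^bsub>loc\<^esub> sub_fraction U P a s"
      unfolding mem by blast
    have pU: "p \<in> U" using p(1) PE(1) by blast
    have F: "F = sub_fraction U P (s \<otimes> p \<oplus> u \<otimes> a) (u \<otimes> s)" using local_add[OF pU p(2) a] p(3) by simp
    have "p \<in> carrier R" "u \<in> carrier R" using pU p(2) Uc by blast+
    then have "(u \<otimes> s) \<otimes> a \<ominus> s \<otimes> (s \<otimes> p \<oplus> u \<otimes> a) = \<ominus> (s \<otimes> s \<otimes> p)" using sc by algebra
    moreover have "\<ominus> (s \<otimes> s \<otimes> p) \<in> P" using PE(7)[OF PE(5)[OF UE(6) p(1)]] a(2) by simp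
    moreover have "s \<otimes> p \<oplus> u \<otimes> a \<in> U" using a pU p(2) by (intro UE(6,7)) simp_all
    ultimately show "F \<in> ?C" unfolding F using denom_mult[OF p(2) a(2)] by (intro residue_classI) simp_all
  next
    fix F assume "F \<in> ?C"
    then obtain b t where b: "b \<in> U" "t \<in> U - P" "t \<otimes> a \<ominus> s \<otimes> b \<in> P" "F = sub_fraction U P b t"
      by (rule residue_classE)
    \<comment> \<open>The fraction \<open>d/(t s)\<close> is the difference
      \<open>b/t - a/s\<close>, so it must be shown to lie in the maximal ideal.\<close>
    define d where "d = s \<otimes> b \<ominus> t \<otimes> a"
    have bc: "b \<in> carrier R" "t \<in> carrier R" using b Uc by blast+
    have "d = \<ominus> (t \<otimes> a \<ominus> s \<otimes> b)" unfolding d_def using bc sc by algebra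
    then have d: "d \<in> P" using PE(7)[OF b(3)] by simp
    then have dU: "d \<in> U" using PE(1) by blast
    note ts = denom_mult[OF b(2) a(2)]
    have "t \<otimes> (s \<otimes> d \<oplus> t \<otimes> s \<otimes> a) = t \<otimes> s \<otimes> s \<otimes> b" unfolding d_def using bc sc by algebra
    then have "\<one> \<otimes> (t \<otimes> (s \<otimes> d \<oplus> t \<otimes> s \<otimes> a)) = \<one> \<otimes> (t \<otimes> s \<otimes> s \<otimes> b)" by simp
    then have "sub_fraction U P (s \<otimes> d \<oplus> t \<otimes> s \<otimes> a) (t \<otimes> s \<otimes> s) = sub_fraction U P b t"
      using a b dU by (intro fraction_eqI[OF _ _ _ _ denom_one] denom_mult UE(6,7)) simp_all
    then have "F = sub_fraction U P d (t \<otimes> s) \<oplus>\<^bsub>loc\<^esub> sub_fraction U P a s"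
      using local_add[OF dU ts a] b(4) by simp
    then show "F \<in> ?L" unfolding mem using d ts by blast
  qed
qed

text \<open>Equality of fractions involves an auxiliary multiplier outside \<open>P\<close>; modulo
  the prime \<open>P\<close> it can be cancelled, leaving plain cross-multiplication.\<close>

lemma residue_class_eq_iff:
  assumes ab: "a \<in> U" "s \<in> U - P" "b \<in> U" "t \<in> U - P"
  shows "residue_class U P a s = residue_class U P b t \<longleftrightarrow> t \<otimes> a \<ominus> s \<otimes> b \<in> P"
proof
  have c: "a \<in> carrier R" "s \<in> carrier R" "b \<in> carrier R" "t \<in> carrier R" using ab Uc by blast+
  assume "residue_class U P a s = residue_class U P b t"
  moreover have "sub_fraction U P b t \<in> residue_class U P b t"
  proof -
    have "t \<otimes> b \<ominus> t \<otimes> b \<in> P" using c PE(3) by (simp add: a_minus_def r_neg)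
    then show ?thesis using ab by (intro residue_classI) simp_all
  qed
  ultimately obtain b' t' where b': "b' \<in> U" "t' \<in> U - P" "t' \<otimes> a \<ominus> s \<otimes> b' \<in> P"
    "sub_fraction U P b t = sub_fraction U P b' t'"
    using residue_classE by metis
  then have "(b', t') \<in> sub_fraction U P b t" using fraction_self by blast
  then obtain u where u: "u \<in> U - P" "u \<otimes> (t' \<otimes> b) = u \<otimes> (t \<otimes> b')" unfolding mem_fraction by blast
  have c': "b' \<in> carrier R" "t' \<in> carrier R" "u \<in> carrier R" using b'(1,2) u(1) Uc by blast+
  have "(u \<otimes> t') \<otimes> (t \<otimes> a \<ominus> s \<otimes> b) = u \<otimes> t \<otimes> (t' \<otimes> a) \<ominus> s \<otimes> (u \<otimes> (t' \<otimes> b))" using c c' by algebra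
  also have "\<dots> = (u \<otimes> t) \<otimes> (t' \<otimes> a \<ominus> s \<otimes> b')" unfolding u(2) using c c' by algebra
  also have "\<dots> \<in> P" using PE(5)[OF UE(6) b'(3)] u(1) ab(4) by simp
  finally have "(u \<otimes> t') \<otimes> (t \<otimes> a \<ominus> s \<otimes> b) \<in> P" .
  moreover have "t \<otimes> a \<ominus> s \<otimes> b \<in> U" using ab by (intro subring_minus[OF U] UE(6)) simp_all
  ultimately show "t \<otimes> a \<ominus> s \<otimes> b \<in> P"
    using rel_primeD(3)[OF P, of "u \<otimes> t'"] denom_mult[OF u(1) b'(2)] by simp
next
  have sub: "residue_class U P a s \<subseteq> residue_class U P b t"
    if ab: "a \<in> U" "s \<in> U - P" "b \<in> U" "t \<in> U - P" and ts: "t \<otimes> a \<ominus> s \<otimes> b \<in> P" for a s b t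
  proof
    fix F assume "F \<in> residue_class U P a s"
    then obtain d r where d: "d \<in> U" "r \<in> U - P" "r \<otimes> a \<ominus> s \<otimes> d \<in> P" "F = sub_fraction U P d r"
      by (rule residue_classE)
    have c: "a \<in> carrier R" "s \<in> carrier R" "b \<in> carrier R" "t \<in> carrier R" "d \<in> carrier R" "r \<in> carrier R"
      using ab d(1,2) Uc by blast+
    have "s \<otimes> (r \<otimes> b \<ominus> t \<otimes> d) = t \<otimes> (r \<otimes> a \<ominus> s \<otimes> d) \<ominus> r \<otimes> (t \<otimes> a \<ominus> s \<otimes> b)" using c by algebra
    also have "\<dots> \<in> P" using PE(8)[OF PE(5)[OF _ d(3)] PE(5)[OF _ ts]] ab(4) d(2) by simp
    finally have "s \<otimes> (r \<otimes> b \<ominus> t \<otimes> d) \<in> P" .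
    moreover have "r \<otimes> b \<ominus> t \<otimes> d \<in> U" using ab d(1,2) by (intro subring_minus[OF U] UE(6)) simp_all
    ultimately have "r \<otimes> b \<ominus> t \<otimes> d \<in> P" using rel_primeD(3)[OF P, of s] ab(2) by simp
    then show "F \<in> residue_class U P b t" unfolding d(4) using d(1,2) by (intro residue_classI)
  qed
  have c: "a \<in> carrier R" "s \<in> carrier R" "b \<in> carrier R" "t \<in> carrier R" using ab Uc by blast+
  assume 1: "t \<otimes> a \<ominus> s \<otimes> b \<in> P"
  have "s \<otimes> b \<ominus> t \<otimes> a = \<ominus> (t \<otimes> a \<ominus> s \<otimes> b)" using c by algebra
  then have "s \<otimes> b \<ominus> t \<otimes> a \<in> P" using PE(7)[OF 1] by simp
  then show "residue_class U P a s = residue_class U P b t" using sub[OF ab 1] sub[OF ab(3,4,1,2)] by blast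
qed

lemma residue_class_nonempty:
  assumes "a \<in> U" "s \<in> U - P"
  shows "sub_fraction U P a s \<in> residue_class U P a s"
proof -
  have "s \<in> carrier R" "a \<in> carrier R" using assms Uc by blast+
  then have "s \<otimes> a \<ominus> s \<otimes> a \<in> P" using PE(3) by (simp add: a_minus_def r_neg)
  then show ?thesis using assms by (intro residue_classI)
qed

abbreviation "res \<equiv> residue_field (R\<lparr>carrier := U\<rparr>) P"

lemma residue_carrier: "carrier res = {residue_class U P a s | a s. a \<in> U \<and> s \<in> U - P}"
proof -
  have "carrier loc = {sub_fraction U P a s | a s. a \<in> U \<and> s \<in> U - P}"
    unfolding local_ring_at_def localization_def quotient_def fraction_def by auto
  then have "carrier res = {local_max_ideal (R\<lparr>carrier := U\<rparr>) P +>\<^bsub>loc\<^esub> sub_fraction U P a s | a s. a \<in> U \<and> s \<in> U - P}"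
    unfolding residue_field_def FactRing_def A_RCOSETS_def' by auto
  also have "\<dots> = {residue_class U P a s | a s. a \<in> U \<and> s \<in> U - P}"
    using coset_fraction by (intro Collect_cong) blast
  finally show ?thesis .
qed

lemma residue_one: "\<one>\<^bsub>res\<^esub> = residue_class U P \<one> \<one>"
proof -
  have "\<one>\<^bsub>res\<^esub> = local_max_ideal (R\<lparr>carrier := U\<rparr>) P +>\<^bsub>loc\<^esub> sub_fraction U P \<one> \<one>"
    unfolding residue_field_def FactRing_def local_ring_at_def localization_def by simp
  then show ?thesis using coset_fraction[OF UE(3) denom_one] by simp
qed

lemma residue_mult:
  assumes ab: "a \<in> U" "s \<in> U - P" "b \<in> U" "t \<in> U - P"
  shows "residue_class U P a s \<otimes>\<^bsub>res\<^esub> residue_class U P b t = residue_class U P (a \<otimes> b) (s \<otimes> t)"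
proof -
  have "local_max_ideal (R\<lparr>carrier := U\<rparr>) P +>\<^bsub>loc\<^esub> (F \<otimes>\<^bsub>loc\<^esub> G) = residue_class U P (a \<otimes> b) (s \<otimes> t)"
    if F: "F \<in> residue_class U P a s" and G: "G \<in> residue_class U P b t" for F G
  proof -
    obtain a' s' where a': "a' \<in> U" "s' \<in> U - P" "s' \<otimes> a \<ominus> s \<otimes> a' \<in> P" "F = sub_fraction U P a' s'"
      using F by (rule residue_classE)
    obtain b' t' where b': "b' \<in> U" "t' \<in> U - P" "t' \<otimes> b \<ominus> t \<otimes> b' \<in> P" "G = sub_fraction U P b' t'"
      using G by (rule residue_classE)
    have c: "a \<in> carrier R" "s \<in> carrier R" "b \<in> carrier R" "t \<in> carrier R" "a' \<in> carrier R"
      "s' \<in> carrier R" "b' \<in> carrier R" "t' \<in> carrier R" using ab a'(1,2) b'(1,2) Uc by blast+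
    have "(s \<otimes> t) \<otimes> (a' \<otimes> b') \<ominus> (s' \<otimes> t') \<otimes> (a \<otimes> b)
        = \<ominus> ((t' \<otimes> b) \<otimes> (s' \<otimes> a \<ominus> s \<otimes> a') \<oplus> (s \<otimes> a') \<otimes> (t' \<otimes> b \<ominus> t \<otimes> b'))" using c by algebra
    also have "\<dots> \<in> P"
      using PE(7)[OF PE(4)[OF PE(5)[OF UE(6) a'(3)] PE(5)[OF UE(6) b'(3)]]] ab a'(1) b'(2) by simp
    finally have "residue_class U P (a' \<otimes> b') (s' \<otimes> t') = residue_class U P (a \<otimes> b) (s \<otimes> t)"
      using residue_class_eq_iff[OF UE(6)[OF a'(1) b'(1)] denom_mult[OF a'(2) b'(2)] UE(6)[OF ab(1,3)]
          denom_mult[OF ab(2,4)]] by blast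
    then show ?thesis
      using local_mult[OF a'(1,2) b'(1,2)] coset_fraction[OF UE(6)[OF a'(1) b'(1)] denom_mult[OF a'(2) b'(2)]]
        a'(4) b'(4) by simp
  qed
  then have "rcoset_mult loc (local_max_ideal (R\<lparr>carrier := U\<rparr>) P) (residue_class U P a s) (residue_class U P b t)
      = residue_class U P (a \<otimes> b) (s \<otimes> t)"
    unfolding rcoset_mult_def using residue_class_nonempty[OF ab(1,2)] residue_class_nonempty[OF ab(3,4)] by blast
  then show ?thesis unfolding residue_field_def FactRing_def by simp
qed

lemma residue_add:
  assumes ab: "a \<in> U" "s \<in> U - P" "b \<in> U" "t \<in> U - P"
  shows "residue_class U P a s \<oplus>\<^bsub>res\<^esub> residue_class U P b t = residue_class U P (t \<otimes> a \<oplus> s \<otimes> b) (s \<otimes> t)"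
proof -
  have mem: "H \<in> residue_class U P a s \<oplus>\<^bsub>res\<^esub> residue_class U P b t \<longleftrightarrow>
      (\<exists>F\<in>residue_class U P a s. \<exists>G\<in>residue_class U P b t. H = F \<oplus>\<^bsub>loc\<^esub> G)" for H
    unfolding residue_field_def FactRing_def set_add_def' by auto
  have cab: "a \<in> carrier R" "s \<in> carrier R" "b \<in> carrier R" "t \<in> carrier R" using ab Uc by blast+
  show ?thesis
  proof (intro equalityI subsetI)
    fix H assume "H \<in> residue_class U P a s \<oplus>\<^bsub>res\<^esub> residue_class U P b t"
    then obtain F G where FG: "F \<in> residue_class U P a s" "G \<in> residue_class U P b t" "H = F \<oplus>\<^bsub>loc\<^esub> G"
      unfolding mem by blast
    obtain a' s' where a': "a' \<in> U" "s' \<in> U - P" "s' \<otimes> a \<ominus> s \<otimes> a' \<in> P" "F = sub_fraction U P a' s'"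
      using FG(1) by (rule residue_classE)
    obtain b' t' where b': "b' \<in> U" "t' \<in> U - P" "t' \<otimes> b \<ominus> t \<otimes> b' \<in> P" "G = sub_fraction U P b' t'"
      using FG(2) by (rule residue_classE)
    have c: "a' \<in> carrier R" "s' \<in> carrier R" "b' \<in> carrier R" "t' \<in> carrier R"
      using a'(1,2) b'(1,2) Uc by blast+
    have H: "H = sub_fraction U P (t' \<otimes> a' \<oplus> s' \<otimes> b') (s' \<otimes> t')"
      using local_add[OF a'(1,2) b'(1,2)] a'(4) b'(4) FG(3) by simp
    have "(s' \<otimes> t') \<otimes> (t \<otimes> a \<oplus> s \<otimes> b) \<ominus> (s \<otimes> t) \<otimes> (t' \<otimes> a' \<oplus> s' \<otimes> b')
        = (t \<otimes> t') \<otimes> (s' \<otimes> a \<ominus> s \<otimes> a') \<oplus> (s \<otimes> s') \<otimes> (t' \<otimes> b \<ominus> t \<otimes> b')" using cab c by algebra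
    also have "\<dots> \<in> P"
      using PE(4)[OF PE(5)[OF UE(6) a'(3)] PE(5)[OF UE(6) b'(3)]] ab a'(2) b'(2) by simp
    finally have "(s' \<otimes> t') \<otimes> (t \<otimes> a \<oplus> s \<otimes> b) \<ominus> (s \<otimes> t) \<otimes> (t' \<otimes> a' \<oplus> s' \<otimes> b') \<in> P" .
    moreover have "t' \<otimes> a' \<oplus> s' \<otimes> b' \<in> U" using a'(1,2) b'(1,2) by (intro UE(6,7)) simp_all
    ultimately show "H \<in> residue_class U P (t \<otimes> a \<oplus> s \<otimes> b) (s \<otimes> t)"
      unfolding H using denom_mult[OF a'(2) b'(2)] by (intro residue_classI)
  next
    fix H assume "H \<in> residue_class U P (t \<otimes> a \<oplus> s \<otimes> b) (s \<otimes> t)"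
    then obtain d r where d: "d \<in> U" "r \<in> U - P"
      and dP: "r \<otimes> (t \<otimes> a \<oplus> s \<otimes> b) \<ominus> (s \<otimes> t) \<otimes> d \<in> P" and dH: "H = sub_fraction U P d r"
      by (rule residue_classE)
    have c: "d \<in> carrier R" "r \<in> carrier R" using d(1,2) Uc by blast+
    \<comment> \<open>Addition in the quotient ring is the elementwise sum of cosets, so
      \<open>d/r\<close> has to be split: the summand in the first class is
      \<open>d/r - b/t\<close>, with numerator \<open>t d - r b\<close> and denominator
      \<open>r t\<close>.\<close>
    have g: "t \<otimes> d \<ominus> r \<otimes> b \<in> U" "r \<otimes> t \<in> U - P"
      using ab d(1,2) denom_mult[OF d(2) ab(4)] by (auto intro!: subring_minus[OF U] UE(6))
    have "(r \<otimes> t) \<otimes> a \<ominus> s \<otimes> (t \<otimes> d \<ominus> r \<otimes> b) = r \<otimes> (t \<otimes> a \<oplus> s \<otimes> b) \<ominus> (s \<otimes> t) \<otimes> d"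
      using cab c by algebra
    then have F: "sub_fraction U P (t \<otimes> d \<ominus> r \<otimes> b) (r \<otimes> t) \<in> residue_class U P a s"
      using g dP by (intro residue_classI) simp_all
    have "r \<otimes> (t \<otimes> (t \<otimes> d \<ominus> r \<otimes> b) \<oplus> (r \<otimes> t) \<otimes> b) = (r \<otimes> t) \<otimes> t \<otimes> d" using cab c by algebra
    then have "\<one> \<otimes> (r \<otimes> (t \<otimes> (t \<otimes> d \<ominus> r \<otimes> b) \<oplus> (r \<otimes> t) \<otimes> b)) = \<one> \<otimes> ((r \<otimes> t) \<otimes> t \<otimes> d)" by simp
    then have "sub_fraction U P (t \<otimes> (t \<otimes> d \<ominus> r \<otimes> b) \<oplus> (r \<otimes> t) \<otimes> b) ((r \<otimes> t) \<otimes> t) = sub_fraction U P d r"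
      using ab d(1,2) g by (intro fraction_eqI[OF _ _ _ _ denom_one] denom_mult UE(6,7)) simp_all
    then have "H = sub_fraction U P (t \<otimes> d \<ominus> r \<otimes> b) (r \<otimes> t) \<oplus>\<^bsub>loc\<^esub> sub_fraction U P b t"
      using local_add[OF g ab(3,4)] dH by simp
    then show "H \<in> residue_class U P a s \<oplus>\<^bsub>res\<^esub> residue_class U P b t"
      unfolding mem using F residue_class_nonempty[OF ab(3,4)] by blast
  qed
qed

end

section \<open>The residual extension in terms of residue classes\<close>

lemma residual_extension_class:
  assumes U: "subring U R" and Q: "rel_prime (carrier R) Q" and a: "a \<in> U" "s \<in> U - Q"
  shows "residual_extension R Q (residue_class U (Q \<inter> U) a s) = residue_class (carrier R) Q a s"
proof -
  note UE = subringE[OF U]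
  have P: "rel_prime U (Q \<inter> U)" using rel_prime_Int[OF U carrier_is_subring UE(1) Q] .
  have D: "U - Q \<inter> U = U - Q" by blast
  have UC: "x \<in> carrier R" if "x \<in> U" for x using that UE(1) by blast
  note coset = coset_fraction[OF carrier_is_subring Q, simplified]
  have "local_max_ideal R Q +>\<^bsub>local_ring_at R Q\<^esub> local_map R Q F = residue_class (carrier R) Q a s"
    if F: "F \<in> residue_class U (Q \<inter> U) a s" for F
  proof -
    obtain b t where b: "b \<in> U" "t \<in> U - Q" "t \<otimes> a \<ominus> s \<otimes> b \<in> Q" "F = sub_fraction U (Q \<inter> U) b t"
      using F unfolding residue_class_def D by blast
    have eq: "fraction R (carrier R - Q) c r = fraction R (carrier R - Q) b t" if cr: "(c, r) \<in> F" for c r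
    proof -
      obtain u where u: "c \<in> U" "r \<in> U - Q" "u \<in> U - Q" "u \<otimes> (r \<otimes> b) = u \<otimes> (t \<otimes> c)"
        using cr[unfolded b(4), unfolded mem_fraction[OF U P], unfolded D] by blast
      have "fraction R (carrier R - Q) b t = fraction R (carrier R - Q) c r"
        using b(1,2) u UC by (intro fraction_eqI[OF carrier_is_subring Q, simplified, of _ _ _ _ u]) auto
      then show ?thesis ..
    qed
    have "(b, t) \<in> F" unfolding b(4) using fraction_self[OF U P] b(1,2) D by simp
    then have "local_map R Q F = fraction R (carrier R - Q) b t" unfolding local_map_def using eq by fast
    moreover have "residue_class (carrier R) Q a s = residue_class (carrier R) Q b t"
      using b a UC by (subst residue_class_eq_iff[OF carrier_is_subring Q]) auto
    ultimately show ?thesis using coset[of b t] b(1,2) UC by simp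
  qed
  \<comment> \<open>The union over a class of constant value is that value only because the class is
    nonempty.\<close>
  moreover have "residue_class U (Q \<inter> U) a s \<noteq> {}"
    using residue_class_nonempty[OF U P, of a s] a D by auto
  ultimately show ?thesis unfolding residual_extension_def by blast
qed

text \<open>The residual map is always a ring homomorphism, and it is injective because
  \<open>Q\<close> and its trace on \<open>U\<close> impose the same congruences on elements of
  \<open>U\<close>. Being an isomorphism therefore amounts to surjectivity.\<close>

lemma residual_iso_iff:
  assumes U: "subring U R" and Q: "rel_prime (carrier R) Q"
  shows "residual_extension R Q \<in> ring_iso (residue_field (R\<lparr>carrier := U\<rparr>) (Q \<inter> U)) (residue_field R Q) \<longleftrightarrow>
     (\<forall>x\<in>carrier R. \<exists>t\<in>U. \<exists>v\<in>U. t \<notin> Q \<and> t \<otimes> x \<ominus> v \<in> Q)" (is "?h \<in> ring_iso ?K ?L \<longleftrightarrow> ?onto")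
proof -
  note UE = subringE[OF U]
  have P: "rel_prime U (Q \<inter> U)" using rel_prime_Int[OF U carrier_is_subring UE(1) Q] .
  have D: "U - Q \<inter> U = U - Q" by blast
  have UC: "x \<in> carrier R" if "x \<in> U" for x using that UE(1) by blast
  have UC': "x \<in> carrier R - Q" if "x \<in> U - Q" for x using that UE(1) by blast
  note Q' = rel_idealD[OF carrier_is_subring rel_primeD(1)[OF Q]]
  let ?k = "residue_class U (Q \<inter> U)" and ?l = "residue_class (carrier R) Q"
  note h = residual_extension_class[OF U Q]
  note K = residue_carrier[OF U P, unfolded D] residue_mult[OF U P, unfolded D] residue_add[OF U P, unfolded D]
    residue_one[OF U P]
  have self: "R\<lparr>carrier := carrier R\<rparr> = R" by simp
  note L = residue_carrier[OF carrier_is_subring Q, unfolded self] residue_mult[OF carrier_is_subring Q, unfolded self]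
    residue_add[OF carrier_is_subring Q, unfolded self] residue_one[OF carrier_is_subring Q, unfolded self]
  have one: "\<one> \<in> U - Q" using UE(3) rel_primeD(2)[OF Q] by blast
  have dm: "s \<otimes> t \<in> U - Q" if "s \<in> U - Q" "t \<in> U - Q" for s t
    using that UE(6)[of s t] UC[of s] UC[of t] rel_primeD(3)[OF Q, of s t] by auto
  have hom: "?h \<in> ring_hom ?K ?L"
  proof (rule ring_hom_memI)
    show "?h x \<in> carrier ?L" if x: "x \<in> carrier ?K" for x
    proof -
      obtain a s where "x = ?k a s" "a \<in> U" "s \<in> U - Q" using x unfolding K(1) by blast
      then have "?h x = ?l a s" "a \<in> carrier R" "s \<in> carrier R - Q" using h UC UC' by simp_all
      then show ?thesis unfolding L(1) by blast
    qed
    show "?h \<one>\<^bsub>?K\<^esub> = \<one>\<^bsub>?L\<^esub>" unfolding K(4) L(4) using h[OF UE(3) one] .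
    fix x y assume "x \<in> carrier ?K" "y \<in> carrier ?K"
    then obtain a s b t where x: "x = ?k a s" "a \<in> U" "s \<in> U - Q" and y: "y = ?k b t" "b \<in> U" "t \<in> U - Q"
      unfolding K(1) by blast
    show "?h (x \<otimes>\<^bsub>?K\<^esub> y) = ?h x \<otimes>\<^bsub>?L\<^esub> ?h y"
      using K(2)[OF x(2,3) y(2,3)] h[OF x(2,3)] h[OF y(2,3)] h[OF UE(6)[OF x(2) y(2)] dm[OF x(3) y(3)]]
        L(2)[of a s b t] x y UC by simp
    have "t \<otimes> a \<oplus> s \<otimes> b \<in> U" using x y by (intro UE(6,7)) simp_all
    then show "?h (x \<oplus>\<^bsub>?K\<^esub> y) = ?h x \<oplus>\<^bsub>?L\<^esub> ?h y"
      using K(3)[OF x(2,3) y(2,3)] h[OF x(2,3)] h[OF y(2,3)] h[OF _ dm[OF x(3) y(3)], of "t \<otimes> a \<oplus> s \<otimes> b"]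
        L(3)[of a s b t] x y UC by simp
  qed
  have inj: "inj_on ?h (carrier ?K)"
  proof (rule inj_onI)
    fix x y assume "x \<in> carrier ?K" "y \<in> carrier ?K" and eq: "?h x = ?h y"
    then obtain a s b t where x: "x = ?k a s" "a \<in> U" "s \<in> U - Q" and y: "y = ?k b t" "b \<in> U" "t \<in> U - Q"
      unfolding K(1) by blast
    have "?l a s = ?l b t" using eq h[OF x(2,3)] h[OF y(2,3)] x(1) y(1) by simp
    then have "t \<otimes> a \<ominus> s \<otimes> b \<in> Q"
      using residue_class_eq_iff[OF carrier_is_subring Q UC[OF x(2)] UC'[OF x(3)] UC[OF y(2)] UC'[OF y(3)]] by blast
    moreover have "t \<otimes> a \<ominus> s \<otimes> b \<in> U" using x y by (intro subring_minus[OF U] UE(6)) simp_all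
    ultimately show "x = y"
      using residue_class_eq_iff[OF U P, unfolded D, OF x(2,3) y(2,3)] x(1) y(1) by blast
  qed
  have "?h ` carrier ?K = carrier ?L \<longleftrightarrow> ?onto"
  proof
    assume surj: "?h ` carrier ?K = carrier ?L"
    show ?onto
    proof
      fix x assume x: "x \<in> carrier R"
      have "?l x \<one> \<in> carrier ?L" unfolding L(1) using x UC'[OF one] by blast
      then obtain v t where v: "v \<in> U" "t \<in> U - Q" "?l x \<one> = ?l v t"
        unfolding surj[symmetric] K(1) using h by auto
      then have "t \<otimes> x \<ominus> \<one> \<otimes> v \<in> Q"
        using residue_class_eq_iff[OF carrier_is_subring Q x UC'[OF one] UC[OF v(1)] UC'[OF v(2)]] by blast
      then show "\<exists>t\<in>U. \<exists>v\<in>U. t \<notin> Q \<and> t \<otimes> x \<ominus> v \<in> Q" using v UC by auto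
    qed
  next
    assume onto: ?onto
    have "y \<in> ?h ` carrier ?K" if y: "y \<in> carrier ?L" for y
    proof -
      obtain a s where a: "y = ?l a s" "a \<in> carrier R" "s \<in> carrier R" "s \<notin> Q" using y unfolding L(1) by blast
      obtain t v where t: "t \<in> U" "v \<in> U" "t \<notin> Q" "t \<otimes> a \<ominus> v \<in> Q" using onto a(2) by blast
      \<comment> \<open>Numerator and denominator are approximated separately:
        \<open>a = v / t\<close> and \<open>s = w / r\<close> modulo \<open>Q\<close> give
        \<open>a / s = (r v) / (t w)\<close>.\<close>
      obtain r w where r: "r \<in> U" "w \<in> U" "r \<notin> Q" "r \<otimes> s \<ominus> w \<in> Q" using onto a(3) by blast
      have c: "t \<in> carrier R" "v \<in> carrier R" "r \<in> carrier R" "w \<in> carrier R" using t r UC by blast+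
      have "r \<otimes> s \<notin> Q" using rel_primeD(3)[OF Q c(3) a(3)] r(3) a(4) by blast
      moreover have "r \<otimes> s = (r \<otimes> s \<ominus> w) \<oplus> w" using c a by algebra
      ultimately have "w \<notin> Q" using Q'(4)[OF r(4), of w] by auto
      then have tw: "t \<otimes> w \<in> U - Q" using dm[of t w] t(1,3) r(2) by blast
      have rv: "r \<otimes> v \<in> U" using UE(6)[OF r(1) t(2)] .
      have "(t \<otimes> w) \<otimes> a \<ominus> s \<otimes> (r \<otimes> v) = (r \<otimes> s) \<otimes> (t \<otimes> a \<ominus> v) \<ominus> (t \<otimes> a) \<otimes> (r \<otimes> s \<ominus> w)"
        using c a(2,3) by algebra
      also have "\<dots> \<in> Q" using Q'(8)[OF Q'(5)[OF _ t(4)] Q'(5)[OF _ r(4)]] c a(2,3) by simp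
      finally have "y = ?l (r \<otimes> v) (t \<otimes> w)"
        using residue_class_eq_iff[OF carrier_is_subring Q a(2) _ UC[OF rv] UC'[OF tw]] a by blast
      then have "y = ?h (?k (r \<otimes> v) (t \<otimes> w))" using h[OF rv tw] by simp
      then show ?thesis unfolding K(1) using rv tw by blast
    qed
    then show "?h ` carrier ?K = carrier ?L" using hom unfolding ring_hom_def by blast
  qed
  then show ?thesis unfolding ring_iso_def bij_betw_def using hom inj by blast
qed

lemma primeideal_iff_rel_prime: "primeideal Q R \<longleftrightarrow> rel_prime (carrier R) Q"
proof
  assume Q: "primeideal Q R"
  interpret Q: primeideal Q R by fact
  have "rel_ideal (carrier R) Q" unfolding rel_ideal_def
    using Q.a_subset Q.zero_closed Q.a_closed Q.I_l_closed by blast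
  moreover have "\<one> \<notin> Q" using Q.I_notcarr Q.one_imp_carrier by blast
  ultimately show "rel_prime (carrier R) Q" unfolding rel_prime_def using Q.I_prime by blast
next
  assume Q: "rel_prime (carrier R) Q"
  note Q' = rel_idealD[OF carrier_is_subring rel_primeD(1)[OF Q]]
  have "ideal Q R"
  proof (rule idealI[OF ring_axioms])
    show "subgroup Q (add_monoid R)"
      by (rule add.subgroupI) (use Q' in \<open>auto simp: a_inv_def[symmetric]\<close>)
  qed (use Q' in auto)
  then show "primeideal Q R"
    using rel_primeD[OF Q] by (intro primeidealI is_cring) auto
qed

lemma infra_integral_iff:
  assumes "subring U R"
  shows "infra_integral_extension R U \<longleftrightarrow> integral_extension R U \<and> residually_onto U (carrier R)"
  unfolding infra_integral_extension_def residually_onto_def primeideal_iff_rel_prime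
  using residual_iso_iff[OF assms] by blast

end

theorem corollary6p22:
  fixes S :: "('a, 'm) ring_scheme" and R :: "'a set"
  assumes "cring S"
    and "subring R S"
    and "R \<subset> carrier S"
    and "integral_extension S R"
    and "FCP_extension S R"
    and "catenarian_extension S R"
  shows "\<exists>V. is_co_infra_integral_closure S R V"
proof -
  interpret S: cring S by fact
  let ?F = "intermediate_rings S R"
  have fin: "finite C" if "subset.chain ?F C" for C
    using assms(5) that unfolding FCP_extension_def by blast
  \<comment> \<open>\<open>chain_length\<close> subtracts one in the naturals, so equal lengths give
    equal cardinalities only for nonempty chains. Maximal chains are nonempty since \<open>R\<close>
    itself is an intermediate ring.\<close>
  have cat: "card C = card D" if C: "subset.maxchain ?F C" and D: "subset.maxchain ?F D" for C D
  proof -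
    have "R \<in> ?F" using assms(2) unfolding intermediate_rings_def by blast
    then have pos: "0 < card E" if "subset.maxchain ?F E" for E
      using that fin[of E] unfolding subset_maxchain_iff by (auto simp: card_gt_0_iff)
    have "card C - 1 = card D - 1"
      using assms(6) C D unfolding catenarian_extension_def chain_length_def by blast
    then show ?thesis using pos[OF C] pos[OF D] by simp
  qed
  obtain rk :: "'a set \<Rightarrow> nat" where rk: "\<forall>V W. covered_in ?F V W \<longrightarrow> rk W = Suc (rk V)"
    "\<forall>V W. V \<in> ?F \<longrightarrow> W \<in> ?F \<longrightarrow> V \<subset> W \<longrightarrow> rk V < rk W"
    using catenary_rank[where \<F> = ?F, OF fin cat] by blast
  have int: "S.integral_over R x" if "x \<in> carrier S" for x
    using assms(4) that unfolding integral_extension_def S.integral_over_def by blast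
  interpret G: graded_integral_extension S R rk
    by unfold_locales (use int fin rk in auto)
  \<comment> \<open>Integrality over \<open>R\<close> passes to every larger intermediate ring, so
    only the residual condition distinguishes the infra-integral extensions.\<close>
  have infra: "infra_integral_extension S V \<longleftrightarrow> S.residually_onto V (carrier S)" if "V \<in> ?F" for V
  proof -
    have "subring V S" "R \<subseteq> V" using that unfolding intermediate_rings_def by auto
    moreover from this have "integral_extension S V"
      using assms(4) unfolding integral_extension_def by blast
    ultimately show ?thesis using S.infra_integral_iff by blast
  qed
  obtain V where "V \<in> ?F" "S.residually_onto V (carrier S)"
    "\<forall>W\<in>?F. S.residually_onto W (carrier S) \<longrightarrow> V \<subseteq> W"
    using G.least_residually_onto[OF assms(2)] by blast
  then show ?thesis unfolding is_co_infra_integral_closure_def using infra by blast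
qed

end
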